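(* Let $A$ be a weak formula over $\mathbf{T}$. Then there exists a weak formula $A'$ over $\mathcal{S}(\mathbf{T})$ such that for all states $P$: $P\models_{\mathbf{T}}A$ iff $P\models_{\mathcal{S}(\mathbf{T})}A'$.
   Context: Setting: a nominal transition system $\mathbf{T}$. It consists of a nominal set of states $P,Q,\ldots$; a nominal set of state predicates $\mathrm{PRED}_{\mathbf{T}}$ (ranged over by $\varphi$); an equivariant relation $P \vdash_{\mathbf{T}} \varphi$; a nominal set of actions $\mathrm{ACT}_{\mathbf{T}}$ with an equivariant function $\operatorname{bn}$ giving each action a finite set of binding names $\operatorname{bn}(\alpha)\subseteq\operatorname{supp}(\alpha)$; and an equivariant transition relation $P \xrightarrow{\alpha} P'$, where the names in $\operatorname{bn}(\alpha)$ bind into $P'$. There is a special silent action $\tau$ with empty support. The transition system $\mathcal{S}(\mathbf{T})$ (state predicates replaced by self-loops) has: the same states as $\mathbf{T}$; actions $\mathrm{ACT}_{\mathbf{T}}\uplus\mathrm{PRED}_{\mathbf{T}}$, with $\operatorname{bn}$ as in $\mathbf{T}$ on $\mathrm{ACT}_{\mathbf{T}}$ and $\operatorname{bn}(\varphi)=\emptyset$ for $\varphi\in\mathrm{PRED}_{\mathbf{T}}$; no state predicates (so $\vdash_{\mathcal{S}(\mathbf{T})}$ is empty); and transitions $P\xrightarrow{\alpha}P'$ in $\mathcal{S}(\mathbf{T})$ iff $P\xrightarrow{\alpha}P'$ in $\mathbf{T}$ (for $\alpha\in\mathrm{ACT}_{\mathbf{T}}$), and $P\xrightarrow{\varphi}P$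 in $\mathcal{S}(\mathbf{T})$ iff $P\vdash_{\mathbf{T}}\varphi$ (for $\varphi\in\mathrm{PRED}_{\mathbf{T}}$). Formulas over a transition system: fix an infinite cardinal $\kappa$ with $\kappa>\aleph_0$ and $\kappa>|\text{states}|$; $A ::= \bigwedge_{i\in I}A_i \mid \neg A \mid \varphi \mid \langle\alpha\rangle A$, the conjunct set having cardinality $<\kappa$ and finite support, with $\operatorname{bn}(\alpha)$ bound in $\langle\alpha\rangle A$. Satisfaction $\models$ is the standard one: conjunction and negation as usual, $P\models\varphi$ iff $P\vdash\varphi$, $P\models\langle\alpha\rangle A$ iff (for an alpha-variant with $\operatorname{bn}(\alpha)$ fresh for $P$) $P\xrightarrow{\alpha}P'$ for some $P'$ with $P'\models A$. Disjunction $\bigvee$ abbreviates $\neg\bigwedge\neg$. Weak modalities: $\langle\langle\tau\rangle\rangle A=\bigvee_{i\in\omega}\langle\tau\rangle^iA$ and $\langle\langle\alpha\rangle\rangle A=\langle\langle\tau\rangle\rangle\langle\alpha\rangle\langle\langle\tau\rangle\rangle A$ for $\alpha\neq\tau$. Weak formulas: $A ::= \bigwedge_{i\in I}A_i \mid \neg A \mid \langle\langle\alpha\rangle\rangle A \mid \langle\langle\tau\rangle\rangle(A\wedge\varphi)$. $\models_{\mathbf{T}}$ and $\models_{\mathcal{S}(\mathbf{T})}$ denote satisfaction in $\mathbf{T}$ and in $\mathcal{S}(\mathbf{T})$ respectively. *)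

theory Defs
  imports Main "HOL-Library.Countable_Set"
begin

unbundle cardinal_syntax

section \<open>Nominal sets\<close>

text \<open>
  Names are multi-sorted, with countably many sorts and countably infinitely many names of each
  sort. Single-sorted nominal sets are those on which permutations act through the names of one
  sort only.
\<close>

datatype name = Name (sort_of: nat) (index_of: nat)

typedef perm = "{f :: name \<Rightarrow> name. bij f \<and> finite {a. f a \<noteq> a} \<and> (\<forall>a. sort_of (f a) = sort_of a)}"
  morphisms apply_perm Perm
  by (rule exI[of _ id]) simp

setup_lifting type_definition_perm

text \<open>As usual for nominal sets in Isabelle, the group of permutations is written additively.\<close>

instantiation perm :: group_add
begin

lift_definition zero_perm :: perm is id by simp

lift_definition plus_perm :: "perm \<Rightarrow> perm \<Rightarrow> perm" is "\<lambda>f g. f \<circ> g"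
proof -
  fix f g :: "name \<Rightarrow> name"
  assume f: "bij f \<and> finite {a. f a \<noteq> a} \<and> (\<forall>a. sort_of (f a) = sort_of a)"
    and g: "bij g \<and> finite {a. g a \<noteq> a} \<and> (\<forall>a. sort_of (g a) = sort_of a)"
  have "finite {a. (f \<circ> g) a \<noteq> a}"
    by (rule finite_subset[of _ "{a. f a \<noteq> a} \<union> {a. g a \<noteq> a}"]) (use f g in auto)
  then show "bij (f \<circ> g) \<and> finite {a. (f \<circ> g) a \<noteq> a} \<and> (\<forall>a. sort_of ((f \<circ> g) a) = sort_of a)"
    using f g by (auto intro: bij_comp)
qed

lift_definition uminus_perm :: "perm \<Rightarrow> perm" is inv
proof -
  fix f :: "name \<Rightarrow> name"
  assume f: "bij f \<and> finite {a. f a \<noteq> a} \<and> (\<forall>a. sort_of (f a) = sort_of a)"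
  then have fi: "f (inv f a) = a" and fj: "inv f (f a) = a" for a
    by (simp_all add: bij_is_surj surj_f_inv_f bij_is_inj)
  have "{a. inv f a \<noteq> a} = {a. f a \<noteq> a}"
    using fi fj by (metis (mono_tags, lifting))
  moreover have "sort_of (inv f a) = sort_of a" for a
    using f fi by metis
  ultimately show "bij (inv f) \<and> finite {a. inv f a \<noteq> a} \<and> (\<forall>a. sort_of (inv f a) = sort_of a)"
    using f by (simp add: bij_imp_bij_inv)
qed

definition minus_perm :: "perm \<Rightarrow> perm \<Rightarrow> perm" where
  "minus_perm p q = p + - q"

instance
proof
  fix p q r :: perm
  show "p + q + r = p + (q + r)" by transfer (simp add: comp_assoc)
  show "0 + p = p" by transfer simp
  show "p + 0 = p" by transfer simp
  show "- p + p = 0" by transfer (simp add: bij_is_inj)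
  show "p + - q = p - q" by (simp add: minus_perm_def)
qed

end

class pt =
  fixes permute :: "perm \<Rightarrow> 'a \<Rightarrow> 'a" (infixr \<open>\<bullet>\<close> 75)
  assumes permute_zero [simp]: "0 \<bullet> x = x"
    and permute_plus: "(p + q) \<bullet> x = p \<bullet> (q \<bullet> x)"

lemma permute_diff: "(p - q) \<bullet> x = p \<bullet> (- q) \<bullet> (x :: 'a::pt)"
  unfolding minus_perm_def by (rule permute_plus)

lemma permute_minus_cancel [simp]:
  "p \<bullet> (- p) \<bullet> x = (x :: 'a::pt)"
  "(- p) \<bullet> p \<bullet> x = x"
  by (simp_all flip: permute_plus)

lemma permute_eq_iff [simp]: "p \<bullet> x = p \<bullet> y \<longleftrightarrow> x = (y :: 'a::pt)"
  by (metis permute_minus_cancel(2))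

instantiation name :: pt
begin
definition permute_name :: "perm \<Rightarrow> name \<Rightarrow> name" where "p \<bullet> a = apply_perm p a"
instance by standard (simp_all add: permute_name_def zero_perm.rep_eq plus_perm.rep_eq)
end

instantiation set :: (pt) pt
begin
definition permute_set :: "perm \<Rightarrow> 'a set \<Rightarrow> 'a set" where "p \<bullet> X = permute p ` X"
instance by standard (auto simp: permute_set_def permute_plus image_iff)
end

instantiation sum :: (pt, pt) pt
begin
definition permute_sum :: "perm \<Rightarrow> 'a + 'b \<Rightarrow> 'a + 'b" where "p \<bullet> s = map_sum (permute p) (permute p) s"
instance
proof
  fix p q :: perm and s :: "'a + 'b"
  show "0 \<bullet> s = s" by (cases s) (simp_all add: permute_sum_def)
  show "(p + q) \<bullet> s = p \<bullet> q \<bullet> s" by (cases s) (simp_all add: permute_sum_def permute_plus)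
qed
end

lemma permute_sum_simps [simp]:
  "p \<bullet> Inl x = Inl (p \<bullet> x)"
  "p \<bullet> Inr y = Inr (p \<bullet> y)"
  by (simp_all add: permute_sum_def)

lemma mem_permute_iff [simp]: "p \<bullet> x \<in> p \<bullet> X \<longleftrightarrow> x \<in> X"
  by (auto simp: permute_set_def)

lemma mem_permute_iff': "x \<in> p \<bullet> X \<longleftrightarrow> - p \<bullet> x \<in> X"
  by (metis mem_permute_iff permute_minus_cancel(1))

definition supports :: "name set \<Rightarrow> 'a::pt \<Rightarrow> bool" where
  "supports S x \<longleftrightarrow> (\<forall>p. (\<forall>a\<in>S. p \<bullet> a = a) \<longrightarrow> p \<bullet> x = x)"

definition finitely_supported :: "'a::pt \<Rightarrow> bool" where
  "finitely_supported x \<longleftrightarrow> (\<exists>S. finite S \<and> supports S x)"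

text \<open>The least finite support of a finitely supported \<open>x\<close>; all names if there is no finite support.\<close>

definition supp :: "'a::pt \<Rightarrow> name set" where
  "supp x = \<Inter>{S. finite S \<and> supports S x}"

class fs = pt +
  assumes finitely_supported: "finitely_supported x"

class bn = fs +
  fixes bn :: "'a::pt \<Rightarrow> name set"
  assumes bn_eqvt: "bn (p \<bullet> x) = p \<bullet> bn x"
    and bn_subset_supp: "bn x \<subseteq> supp x"

lemma supports_permute:
  assumes "supports S x"
  shows "supports (p \<bullet> S) (p \<bullet> x)"
  unfolding supports_def
proof (intro allI impI)
  fix q assume q: "\<forall>a\<in>p \<bullet> S. q \<bullet> a = a"
  have "\<forall>a\<in>S. (- p + q + p) \<bullet> a = a"
    using q by (auto simp: permute_plus permute_set_def)
  then have "(- p + q + p) \<bullet> x = x"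
    using assms by (simp add: supports_def)
  then have "p \<bullet> (- p + q + p) \<bullet> x = p \<bullet> x" by simp
  then show "q \<bullet> p \<bullet> x = p \<bullet> x"
    by (simp add: permute_plus)
qed

lemma finite_permute [simp]: "finite (p \<bullet> X) \<longleftrightarrow> finite X"
  by (simp add: permute_set_def finite_image_iff inj_on_def)

lemma finitely_supported_permute [simp]: "finitely_supported (p \<bullet> x) \<longleftrightarrow> finitely_supported x"
  unfolding finitely_supported_def
  by (metis finite_permute permute_minus_cancel(2) supports_permute)

lemma supp_eqvt: "supp (p \<bullet> x) = p \<bullet> supp x"
proof -
  have *: "S \<in> {S. finite S \<and> supports S (p \<bullet> x)} \<longleftrightarrow> - p \<bullet> S \<in> {S. finite S \<and> supports S x}" for S
    by (metis (mono_tags, lifting) finite_permute mem_Collect_eq permute_minus_cancel supports_permute)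
  show ?thesis
  proof (rule set_eqI)
    fix a
    have "a \<in> supp (p \<bullet> x) \<longleftrightarrow> (\<forall>S. - p \<bullet> S \<in> {S. finite S \<and> supports S x} \<longrightarrow> a \<in> S)"
      unfolding supp_def using * by blast
    also have "\<dots> \<longleftrightarrow> (\<forall>S\<in>{S. finite S \<and> supports S x}. a \<in> p \<bullet> S)"
      by (metis permute_minus_cancel)
    also have "\<dots> \<longleftrightarrow> a \<in> p \<bullet> supp x"
      by (simp add: mem_permute_iff' supp_def)
    finally show "a \<in> supp (p \<bullet> x) \<longleftrightarrow> a \<in> p \<bullet> supp x" .
  qed
qed

lemma obtain_fresh_perm:
  fixes A B C :: "name set"
  assumes "finite A" "finite B" "A \<inter> C = {}" "C \<subseteq> B"
  obtains q where "(q \<bullet> A) \<inter> B = {}" "\<forall>a\<in>C. q \<bullet> a = a"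
proof -
  obtain N where N: "\<forall>a\<in>A \<union> B. index_of a < N"
    using assms(1,2) finite_nat_set_iff_bounded[of "index_of ` (A \<union> B)"] by auto
  define up down where "up a = Name (sort_of a) (index_of a + N)"
    and "down a = Name (sort_of a) (index_of a - N)" for a
  define f where "f a = (if a \<in> A then up a else if a \<in> up ` A then down a else a)" for a
  have down_up: "down (up a) = a" for a by (simp add: up_def down_def)
  have up_B: "up a \<notin> A \<union> B" for a
  proof
    assume "up a \<in> A \<union> B"
    then have "index_of (up a) < N" using N by blast
    then show False by (simp add: up_def)
  qed
  have ff: "f (f a) = a" for a
    using up_B by (auto simp: f_def down_up)
  have "bij f" by (rule o_bij[of f]) (auto simp: ff)
  moreover have "finite {a. f a \<noteq> a}"
    by (rule finite_subset[of _ "A \<union> up ` A"]) (auto simp: f_def assms(1))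
  moreover have "sort_of (f a) = sort_of a" for a
    by (simp add: f_def up_def down_def)
  ultimately have f: "apply_perm (Perm f) = f" by (simp add: Perm_inverse)
  show thesis
  proof (rule that)
    show "(Perm f \<bullet> A) \<inter> B = {}"
      using up_B by (auto simp: permute_set_def permute_name_def f f_def)
    show "\<forall>a\<in>C. Perm f \<bullet> a = a"
      using up_B assms(3,4) by (auto simp: permute_name_def f f_def)
  qed
qed

lemma supports_Int:
  assumes "finite S" "supports S x" "finite R" "supports R x"
  shows "supports (S \<inter> R) x"
  unfolding supports_def
proof (intro allI impI)
  fix p :: perm assume p: "\<forall>a\<in>S \<inter> R. p \<bullet> a = a"
  have fin: "finite {a :: name. p \<bullet> a \<noteq> a}"
    using apply_perm[of p] by (simp add: permute_name_def)
  obtain q where q: "(q \<bullet> (R - S)) \<inter> (S \<union> {a. p \<bullet> a \<noteq> a}) = {}" "\<forall>a\<in>S. q \<bullet> a = a"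
    by (rule obtain_fresh_perm[of "R - S" "S \<union> {a. p \<bullet> a \<noteq> a}" S]) (use assms fin in auto)
  have "q \<bullet> x = x" using q(2) assms(2) by (simp add: supports_def)
  then have "supports (q \<bullet> R) x" using supports_permute[OF assms(4), of q] by simp
  moreover have "\<forall>a\<in>q \<bullet> R. p \<bullet> a = a"
  proof
    fix a assume "a \<in> q \<bullet> R"
    then obtain b where b: "b \<in> R" "a = q \<bullet> b" by (auto simp: permute_set_def)
    show "p \<bullet> a = a"
    proof (cases "b \<in> S")
      case True
      then show ?thesis using b q(2) p by auto
    next
      case False
      then have "a \<in> q \<bullet> (R - S)" using b by simp
      then show ?thesis using q(1) by blast
    qed
  qed
  ultimately show "p \<bullet> x = x" by (simp add: supports_def)
qed

lemma finitely_supported_supp: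
  assumes "finitely_supported x"
  shows "finite (supp x)" "supports (supp x) x"
proof -
  let ?P = "\<lambda>S. finite S \<and> supports S x"
  obtain S where S: "?P S" "\<forall>R. ?P R \<longrightarrow> card S \<le> card R"
    using assms ex_has_least_nat[of ?P _ card] by (auto simp: finitely_supported_def)
  have "S \<subseteq> R" if "?P R" for R
  proof -
    have "?P (S \<inter> R)" using that S(1) supports_Int by blast
    then have "S \<inter> R = S" using S by (metis Int_lower1 card_seteq)
    then show ?thesis by blast
  qed
  then have "supp x = S" using S(1) unfolding supp_def by blast
  then show "finite (supp x)" "supports (supp x) x" using S(1) by simp_all
qed

lemma permute_eq_if_supp_fixed:
  fixes x :: "'a::fs"
  shows "\<forall>a\<in>supp x. p \<bullet> a = a \<Longrightarrow> p \<bullet> x = x"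
  using finitely_supported_supp(2)[OF finitely_supported[of x]] by (simp add: supports_def)

lemma supports_sum [simp]:
  "supports S (Inl x) \<longleftrightarrow> supports S x"
  "supports S (Inr y) \<longleftrightarrow> supports S y"
  by (simp_all add: supports_def)

lemma supp_sum [simp]: "supp (Inl x) = supp x" "supp (Inr y) = supp y"
  by (simp_all add: supp_def)

instance sum :: (fs, fs) fs
proof
  fix s :: "'a + 'b"
  show "finitely_supported s"
    using finitely_supported[where 'a = 'a] finitely_supported[where 'a = 'b]
    by (cases s) (auto simp: finitely_supported_def)
qed

instantiation sum :: (bn, fs) bn
begin
definition bn_sum :: "'a + 'b \<Rightarrow> name set" where "bn_sum s = case_sum bn (\<lambda>_. {}) s"
instance
proof
  fix p :: perm and s :: "'a + 'b"
  show "bn (p \<bullet> s) = p \<bullet> bn s"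
    by (cases s) (simp_all add: bn_sum_def bn_eqvt permute_set_def[of p "{}"])
  show "bn s \<subseteq> supp s"
    by (cases s) (simp_all add: bn_sum_def bn_subset_supp)
qed
end

section \<open>Formulas\<close>

text \<open>
  Raw formulas, before identification up to alpha-equivalence. The type \<open>'k\<close> represents the
  cardinal \<open>\<kappa>\<close>, and \<open>TConj I t\<close> is the conjunction of the \<open>t i\<close> for \<open>i \<in> I\<close>; the values of \<open>t\<close>
  outside \<open>I\<close> are irrelevant.
\<close>

datatype ('k, 'p, 'a) tree =
  TConj "'k set" "'k \<Rightarrow> ('k, 'p, 'a) tree"
| TNeg "('k, 'p, 'a) tree"
| TPred 'p
| TAct 'a "('k, 'p, 'a) tree"

instantiation tree :: (type, pt, pt) pt
begin

primrec permute_tree :: "perm \<Rightarrow> ('a, 'b, 'c) tree \<Rightarrow> ('a, 'b, 'c) tree" where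
  "permute_tree p (TConj I t) = TConj I (\<lambda>i. permute_tree p (t i))"
| "permute_tree p (TNeg t) = TNeg (permute_tree p t)"
| "permute_tree p (TPred \<phi>) = TPred (p \<bullet> \<phi>)"
| "permute_tree p (TAct \<alpha> t) = TAct (p \<bullet> \<alpha>) (permute_tree p t)"

instance
proof
  fix p q :: perm and t :: "('a, 'b, 'c) tree"
  show "0 \<bullet> t = t" by (induction t) simp_all
  show "(p + q) \<bullet> t = p \<bullet> q \<bullet> t" by (induction t) (simp_all add: permute_plus)
qed

end

text \<open>
  Alpha-equivalence. Conjunctions are compared as sets of conjuncts. In the last clause,
  \<open>supp (Collect (alpha t))\<close> is the support of the alpha-equivalence class of \<open>t\<close>, that is,
  the set of free names of \<open>t\<close>. (In an infinitary conjunction, these are not in general the union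
  of the free names of the conjuncts.)
\<close>

primrec alpha :: "('k, 'p::pt, 'a::bn) tree \<Rightarrow> ('k, 'p, 'a) tree \<Rightarrow> bool" where
  "alpha (TConj I t) u \<longleftrightarrow> (\<exists>J v. u = TConj J v \<and>
     (\<forall>i\<in>I. \<exists>j\<in>J. alpha (t i) (v j)) \<and> (\<forall>j\<in>J. \<exists>i\<in>I. alpha (t i) (v j)))"
| "alpha (TNeg t) u \<longleftrightarrow> (\<exists>v. u = TNeg v \<and> alpha t v)"
| "alpha (TPred \<phi>) u \<longleftrightarrow> u = TPred \<phi>"
| "alpha (TAct \<alpha> t) u \<longleftrightarrow> (\<exists>p v. alpha t v \<and> u = TAct (p \<bullet> \<alpha>) (p \<bullet> v) \<and>
     (\<forall>a \<in> supp \<alpha> \<union> supp (Collect (alpha t)) - bn \<alpha>. p \<bullet> a = a))"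

primrec wf_tree :: "('k, 'p::pt, 'a::bn) tree \<Rightarrow> bool" where
  "wf_tree (TConj I t) \<longleftrightarrow> |I| <o |UNIV :: 'k set| \<and>
     finitely_supported ((\<lambda>i. Collect (alpha (t i))) ` I) \<and> (\<forall>i\<in>I. wf_tree (t i))"
| "wf_tree (TNeg t) \<longleftrightarrow> wf_tree t"
| "wf_tree (TPred \<phi>) \<longleftrightarrow> True"
| "wf_tree (TAct \<alpha> t) \<longleftrightarrow> wf_tree t"

lemma alpha_refl [simp]: "alpha t t"
proof (induction t)
  case (TAct \<alpha> t)
  then show ?case by simp (metis permute_zero)
qed auto

lemma alpha_permute_aux: "alpha (p \<bullet> t) u \<longleftrightarrow> alpha t (- p \<bullet> u)"
proof (induction t arbitrary: u)
  case (TConj I t)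
  then show ?case by (cases u) auto
next
  case (TNeg t)
  then show ?case by (cases u) auto
next
  case (TPred \<phi>)
  show ?case by simp (metis permute_minus_cancel permute_tree.simps(3))
next
  case (TAct \<alpha> t)
  have cls: "Collect (alpha (p \<bullet> t)) = p \<bullet> Collect (alpha t)"
    by (rule set_eqI) (simp add: mem_permute_iff' TAct.IH)
  have free: "supp (p \<bullet> \<alpha>) \<union> supp (Collect (alpha (p \<bullet> t))) - bn (p \<bullet> \<alpha>) =
      p \<bullet> (supp \<alpha> \<union> supp (Collect (alpha t)) - bn \<alpha>)" (is "?F' = p \<bullet> ?F")
    unfolding cls supp_eqvt bn_eqvt by (auto simp: mem_permute_iff')
  show ?case
  proof
    assume "alpha (p \<bullet> TAct \<alpha> t) u"
    then obtain q v where v: "alpha (p \<bullet> t) v" "u = TAct (q \<bullet> p \<bullet> \<alpha>) (q \<bullet> v)"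
      and q: "\<forall>a\<in>?F'. q \<bullet> a = a" by auto
    have "alpha t (- p \<bullet> v)" using v TAct.IH by simp
    moreover have "- p \<bullet> u = TAct ((- p + q + p) \<bullet> \<alpha>) ((- p + q + p) \<bullet> - p \<bullet> v)"
      using v by (simp add: permute_plus permute_diff)
    moreover have "\<forall>a\<in>?F. (- p + q + p) \<bullet> a = a"
    proof
      fix a assume "a \<in> ?F"
      then have "p \<bullet> a \<in> ?F'" unfolding free by simp
      then show "(- p + q + p) \<bullet> a = a" using q by (simp add: permute_plus permute_diff)
    qed
    ultimately show "alpha (TAct \<alpha> t) (- p \<bullet> u)" by auto
  next
    assume "alpha (TAct \<alpha> t) (- p \<bullet> u)"
    then obtain q v where v: "alpha t v" "- p \<bullet> u = TAct (q \<bullet> \<alpha>) (q \<bullet> v)"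
      and q: "\<forall>a\<in>?F. q \<bullet> a = a" by auto
    have "alpha (p \<bullet> t) (p \<bullet> v)" using v TAct.IH by simp
    moreover have "u = TAct ((p + q + - p) \<bullet> p \<bullet> \<alpha>) ((p + q + - p) \<bullet> p \<bullet> v)"
      using arg_cong[OF v(2), of "permute p"] by (simp add: permute_plus permute_diff)
    moreover have "\<forall>a\<in>?F'. (p + q + - p) \<bullet> a = a"
      using q unfolding free by (simp add: permute_plus permute_diff mem_permute_iff' del: Diff_iff Un_iff)
    ultimately show "alpha (p \<bullet> TAct \<alpha> t) u"
      unfolding permute_tree.simps alpha.simps by blast
  qed
qed

lemma alpha_permute [simp]: "alpha (p \<bullet> t) (p \<bullet> u) \<longleftrightarrow> alpha t u"
  by (simp add: alpha_permute_aux)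

lemma alpha_class_permute: "Collect (alpha (p \<bullet> t)) = p \<bullet> Collect (alpha t)"
  by (auto simp: mem_permute_iff' alpha_permute_aux)

lemma alpha_imp_same_class: "alpha t u \<Longrightarrow> alpha u w \<longleftrightarrow> alpha t w"
proof (induction t arbitrary: u w)
  case (TConj I t)
  then have IH: "alpha (t i) u \<Longrightarrow> alpha u w = alpha (t i) w" for i u w by blast
  from TConj.prems obtain J v where u: "u = TConj J v"
    and v: "\<forall>i\<in>I. \<exists>j\<in>J. alpha (t i) (v j)" "\<forall>j\<in>J. \<exists>i\<in>I. alpha (t i) (v j)" by auto
  show ?case
  proof (cases w)
    case (TConj K s)
    have "(\<forall>j\<in>J. \<exists>k\<in>K. alpha (v j) (s k)) \<longleftrightarrow> (\<forall>i\<in>I. \<exists>k\<in>K. alpha (t i) (s k))"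
    proof safe
      fix i assume *: "\<forall>j\<in>J. \<exists>k\<in>K. alpha (v j) (s k)" "i \<in> I"
      then obtain j where "j \<in> J" "alpha (t i) (v j)" using v by blast
      with * IH show "\<exists>k\<in>K. alpha (t i) (s k)" by blast
    next
      fix j assume *: "\<forall>i\<in>I. \<exists>k\<in>K. alpha (t i) (s k)" "j \<in> J"
      then obtain i where "i \<in> I" "alpha (t i) (v j)" using v by blast
      with * IH show "\<exists>k\<in>K. alpha (v j) (s k)" by blast
    qed
    moreover have "(\<exists>j\<in>J. alpha (v j) (s k)) \<longleftrightarrow> (\<exists>i\<in>I. alpha (t i) (s k))" for k
    proof safe
      fix j assume *: "j \<in> J" "alpha (v j) (s k)"
      then obtain i where "i \<in> I" "alpha (t i) (v j)" using v by blast
      with * IH show "\<exists>i\<in>I. alpha (t i) (s k)" by blast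
    next
      fix i assume *: "i \<in> I" "alpha (t i) (s k)"
      then obtain j where "j \<in> J" "alpha (t i) (v j)" using v by blast
      with * IH show "\<exists>j\<in>J. alpha (v j) (s k)" by blast
    qed
    ultimately show ?thesis unfolding u TConj by simp
  qed (simp_all add: u)
next
  case (TNeg t)
  from TNeg.prems obtain v where u: "u = TNeg v" and v: "alpha t v" by auto
  show ?case by (simp add: u TNeg.IH[OF v])
next
  case (TPred \<phi>)
  then show ?case by auto
next
  case (TAct \<alpha> t)
  from TAct.prems obtain p v where v: "alpha t v" and u: "u = TAct (p \<bullet> \<alpha>) (p \<bullet> v)"
    and p: "\<forall>a \<in> supp \<alpha> \<union> supp (Collect (alpha t)) - bn \<alpha>. p \<bullet> a = a" (is "\<forall>a\<in>?F. _") by auto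
  have tv: "Collect (alpha v) = Collect (alpha t)" using TAct.IH[OF v] by auto
  have "supp (p \<bullet> \<alpha>) \<union> supp (Collect (alpha (p \<bullet> v))) - bn (p \<bullet> \<alpha>) = p \<bullet> ?F"
    unfolding alpha_class_permute supp_eqvt bn_eqvt tv by (auto simp: mem_permute_iff')
  also have "p \<bullet> ?F = ?F" using p by (force simp: permute_set_def)
  finally have F: "supp (p \<bullet> \<alpha>) \<union> supp (Collect (alpha (p \<bullet> v))) - bn (p \<bullet> \<alpha>) = ?F" .
  have p': "\<forall>a\<in>?F. - p \<bullet> a = a" using p by (metis permute_minus_cancel(2))
  show ?case
  proof
    assume "alpha u w"
    then obtain q s where s: "alpha (p \<bullet> v) s" "w = TAct (q \<bullet> p \<bullet> \<alpha>) (q \<bullet> s)"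
      and q: "\<forall>a\<in>?F. q \<bullet> a = a" unfolding u alpha.simps F by auto
    have "alpha t (- p \<bullet> s)" using s(1) TAct.IH[OF v] by (simp add: alpha_permute_aux)
    moreover have "w = TAct ((q + p) \<bullet> \<alpha>) ((q + p) \<bullet> - p \<bullet> s)"
      using s(2) by (simp add: permute_plus permute_diff)
    moreover have "\<forall>a\<in>?F. (q + p) \<bullet> a = a" using p q by (simp add: permute_plus permute_diff)
    ultimately show "alpha (TAct \<alpha> t) w" unfolding alpha.simps by blast
  next
    assume "alpha (TAct \<alpha> t) w"
    then obtain q s where s: "alpha t s" "w = TAct (q \<bullet> \<alpha>) (q \<bullet> s)"
      and q: "\<forall>a\<in>?F. q \<bullet> a = a" by auto
    have "alpha (p \<bullet> v) (p \<bullet> s)" using s(1) TAct.IH[OF v] by simp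
    moreover have "w = TAct ((q + - p) \<bullet> p \<bullet> \<alpha>) ((q + - p) \<bullet> p \<bullet> s)"
      using s(2) by (simp add: permute_plus permute_diff)
    moreover have "\<forall>a\<in>?F. (q + - p) \<bullet> a = a" using p' q by (simp add: permute_plus permute_diff)
    ultimately show "alpha u w" unfolding u alpha.simps F by blast
  qed
qed

lemma alpha_iff_same_class: "alpha t u \<longleftrightarrow> Collect (alpha t) = Collect (alpha u)"
  using alpha_imp_same_class by (metis alpha_refl mem_Collect_eq Collect_cong)

lemma wf_tree_permute [simp]: "wf_tree (p \<bullet> t) \<longleftrightarrow> wf_tree t"
proof (induction t)
  case (TConj I t)
  have "(\<lambda>i. Collect (alpha (p \<bullet> t i))) ` I = p \<bullet> (\<lambda>i. Collect (alpha (t i))) ` I"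
    by (simp add: alpha_class_permute permute_set_def[of p "_ ` _"] image_image)
  then show ?case using TConj by simp
qed simp_all

text \<open>
  Formulas are well-formed trees modulo alpha-equivalence. (Well-formedness is required on both
  sides since alpha-equivalence does not preserve the cardinality of index sets.)
\<close>

quotient_type (overloaded) ('k, 'p, 'a) formula = "('k, 'p::pt, 'a::bn) tree" /
    partial: "\<lambda>t u. wf_tree t \<and> wf_tree u \<and> alpha t u"
proof (rule part_equivpI)
  show "\<exists>t :: ('k, 'p, 'a) tree. wf_tree t \<and> wf_tree t \<and> alpha t t"
    by (rule exI[of _ "TPred undefined"]) simp
  show "symp (\<lambda>t u :: ('k, 'p, 'a) tree. wf_tree t \<and> wf_tree u \<and> alpha t u)"
    by (rule sympI) (simp add: alpha_iff_same_class)
  show "transp (\<lambda>t u :: ('k, 'p, 'a) tree. wf_tree t \<and> wf_tree u \<and> alpha t u)"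
    by (rule transpI) (simp add: alpha_iff_same_class)
qed

lemma wf_tree_rep [simp]: "wf_tree (rep_formula A)"
  using Quotient_rep_reflp[OF Quotient_formula] by blast

lemma abs_rep_formula [simp]: "abs_formula (rep_formula A) = A"
  using Quotient_abs_rep[OF Quotient_formula] .

lemma abs_formula_eq_iff:
  "wf_tree t \<Longrightarrow> wf_tree u \<Longrightarrow> abs_formula t = abs_formula u \<longleftrightarrow> alpha t u"
  using Quotient_rel[OF Quotient_formula, of t u] by auto

lemma alpha_rep_abs: "wf_tree t \<Longrightarrow> alpha t (rep_formula (abs_formula t))"
  using abs_formula_eq_iff[of t "rep_formula (abs_formula t)"] by simp

instantiation formula :: (type, pt, bn) pt
begin

lift_definition permute_formula :: "perm \<Rightarrow> ('a, 'b, 'c) formula \<Rightarrow> ('a, 'b, 'c) formula"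
  is permute by simp

instance
proof
  fix p q :: perm and A :: "('a, 'b, 'c) formula"
  show "0 \<bullet> A = A" by transfer simp
  show "(p + q) \<bullet> A = p \<bullet> q \<bullet> A" by transfer (simp add: permute_plus permute_diff)
qed

end

text \<open>
  The sets whose conjunction is a formula. \<open>Conj X\<close> is only meaningful for such sets \<open>X\<close>.
\<close>

definition conjunctible :: "('k, 'p::pt, 'a::bn) formula set \<Rightarrow> bool" where
  "conjunctible X \<longleftrightarrow> |X| <o |UNIV :: 'k set| \<and> finitely_supported X"

definition Conj :: "('k, 'p::pt, 'a::bn) formula set \<Rightarrow> ('k, 'p, 'a) formula" where
  "Conj X = abs_formula (SOME t. \<exists>I u. t = TConj I u \<and> |I| <o |UNIV :: 'k set| \<and>
     (\<forall>i\<in>I. wf_tree (u i)) \<and> (\<lambda>i. abs_formula (u i)) ` I = X)"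

lift_definition Neg :: "('k, 'p::pt, 'a::bn) formula \<Rightarrow> ('k, 'p, 'a) formula" is TNeg
  by simp

lift_definition Pred :: "'p \<Rightarrow> ('k, 'p::pt, 'a::bn) formula" is TPred
  by simp

lift_definition Act :: "'a \<Rightarrow> ('k, 'p::pt, 'a::bn) formula \<Rightarrow> ('k, 'p, 'a) formula" is TAct
proof -
  fix \<alpha> :: 'a and t u :: "('k, 'p, 'a) tree"
  assume "wf_tree t \<and> wf_tree u \<and> alpha t u"
  then show "wf_tree (TAct \<alpha> t) \<and> wf_tree (TAct \<alpha> u) \<and> alpha (TAct \<alpha> t) (TAct \<alpha> u)"
    by simp (metis permute_zero)
qed

lemma abs_permute: "wf_tree t \<Longrightarrow> p \<bullet> abs_formula t = abs_formula (p \<bullet> t)"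
  by (rule permute_formula.abs_eq) simp

lemma abs_Neg: "wf_tree t \<Longrightarrow> abs_formula (TNeg t) = Neg (abs_formula t)"
  by (rule Neg.abs_eq[symmetric]) simp

lemma abs_Act: "wf_tree t \<Longrightarrow> abs_formula (TAct \<alpha> t) = Act \<alpha> (abs_formula t)"
  by (rule Act.abs_eq[symmetric]) simp

lemma finitely_supported_conjuncts:
  fixes u :: "'k \<Rightarrow> ('k, 'p::pt, 'a::bn) tree"
  assumes "\<forall>i\<in>I. wf_tree (u i)"
  shows "finitely_supported ((\<lambda>i. Collect (alpha (u i))) ` I) \<longleftrightarrow>
    finitely_supported ((\<lambda>i. abs_formula (u i)) ` I)"
proof -
  let ?f = "\<lambda>A :: ('k, 'p, 'a) formula. Collect (alpha (rep_formula A))"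
  let ?X = "(\<lambda>i. abs_formula (u i)) ` I"
  have 1: "?f (abs_formula t) = Collect (alpha t)" if "wf_tree t" for t
    using alpha_rep_abs[OF that] by (simp add: alpha_iff_same_class)
  have inj: "inj ?f"
    by (rule injI) (metis abs_formula_eq_iff abs_rep_formula alpha_iff_same_class wf_tree_rep)
  have eqvt: "?f (p \<bullet> A) = p \<bullet> ?f A" for p A
    using 1[of "p \<bullet> rep_formula A"] abs_permute[of "rep_formula A" p]
    by (simp add: alpha_class_permute)
  have "(\<lambda>i. Collect (alpha (u i))) ` I = ?f ` ?X"
    using assms 1 by (auto simp: image_image)
  moreover have "p \<bullet> ?f ` ?X = ?f ` ?X \<longleftrightarrow> p \<bullet> ?X = ?X" for p
  proof -
    have "p \<bullet> ?f ` ?X = ?f ` (p \<bullet> ?X)"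
      by (simp add: permute_set_def[of p "_ ` _"] image_image eqvt)
    then show ?thesis by (simp add: inj_image_eq_iff[OF inj])
  qed
  ultimately show ?thesis by (simp add: finitely_supported_def supports_def)
qed

lemma Conj_rep:
  fixes X :: "('k, 'p::pt, 'a::bn) formula set"
  assumes "conjunctible X"
  obtains I u where "Conj X = abs_formula (TConj I u)" "wf_tree (TConj I u)"
    "(\<lambda>i. abs_formula (u i)) ` I = X"
proof -
  let ?P = "\<lambda>t. \<exists>I u. t = TConj I u \<and> |I| <o |UNIV :: 'k set| \<and>
     (\<forall>i\<in>I. wf_tree (u i)) \<and> (\<lambda>i. abs_formula (u i)) ` I = X"
  have X: "|X| <o |UNIV :: 'k set|" "finitely_supported X"
    using assms by (simp_all add: conjunctible_def)
  then obtain f :: "_ \<Rightarrow> 'k" where f: "inj_on f X"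
    using card_of_ordLeq[of X "UNIV :: 'k set"] ordLess_imp_ordLeq by auto
  have "|f ` X| <o |UNIV :: 'k set|"
    using card_of_image X(1) ordLeq_ordLess_trans by blast
  moreover have "(\<lambda>i. abs_formula (rep_formula (the_inv_into X f i))) ` f ` X = X"
    using f by (simp add: image_image the_inv_into_f_f)
  ultimately have "?P (TConj (f ` X) (\<lambda>i. rep_formula (the_inv_into X f i)))" by auto
  then have "?P (SOME t. ?P t)" by (rule someI)
  then obtain I u where u: "(SOME t. ?P t) = TConj I u" "|I| <o |UNIV :: 'k set|"
     "\<forall>i\<in>I. wf_tree (u i)" "(\<lambda>i. abs_formula (u i)) ` I = X" by blast
  show thesis
  proof (rule that)
    show "Conj X = abs_formula (TConj I u)" unfolding Conj_def u(1) ..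
    show "wf_tree (TConj I u)" using u X(2) by (simp add: finitely_supported_conjuncts)
  qed (fact u(4))
qed

lemma conjunctible_image:
  assumes "wf_tree (TConj I u)"
  shows "conjunctible ((\<lambda>i. abs_formula (u i)) ` I)"
  unfolding conjunctible_def
proof
  show "|(\<lambda>i. abs_formula (u i)) ` I| <o |UNIV :: 'a set|"
    using ordLeq_ordLess_trans[OF card_of_image] assms by auto
  show "finitely_supported ((\<lambda>i. abs_formula (u i)) ` I)"
    using assms finitely_supported_conjuncts[of I u] by simp
qed

lemma alpha_TConj_iff:
  assumes "wf_tree (TConj I u)" "wf_tree (TConj J v)"
  shows "alpha (TConj I u) (TConj J v) \<longleftrightarrow>
    (\<lambda>i. abs_formula (u i)) ` I = (\<lambda>j. abs_formula (v j)) ` J"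
proof -
  have "alpha (u i) (v j) \<longleftrightarrow> abs_formula (u i) = abs_formula (v j)" if "i \<in> I" "j \<in> J" for i j
    using that assms by (simp add: abs_formula_eq_iff)
  then have "alpha (TConj I u) (TConj J v) \<longleftrightarrow>
      (\<forall>i\<in>I. \<exists>j\<in>J. abs_formula (u i) = abs_formula (v j)) \<and>
      (\<forall>j\<in>J. \<exists>i\<in>I. abs_formula (u i) = abs_formula (v j))"
    by simp
  also have "\<dots> \<longleftrightarrow> (\<lambda>i. abs_formula (u i)) ` I = (\<lambda>j. abs_formula (v j)) ` J"
    unfolding set_eq_subset image_subset_iff image_iff by (metis (no_types))
  finally show ?thesis .
qed

lemma abs_Conj:
  assumes "wf_tree (TConj I u)"
  shows "abs_formula (TConj I u) = Conj ((\<lambda>i. abs_formula (u i)) ` I)"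
proof -
  obtain J v where v: "Conj ((\<lambda>i. abs_formula (u i)) ` I) = abs_formula (TConj J v)"
    "wf_tree (TConj J v)" "(\<lambda>i. abs_formula (v i)) ` J = (\<lambda>i. abs_formula (u i)) ` I"
    using Conj_rep[OF conjunctible_image[OF assms]] .
  then show ?thesis
    using assms alpha_TConj_iff[OF assms v(2)] by (simp only: v(1) abs_formula_eq_iff)
qed

lemma Conj_eq_iff [simp]:
  assumes "conjunctible X" "conjunctible Y"
  shows "Conj X = Conj Y \<longleftrightarrow> X = Y"
proof -
  obtain I u where u: "Conj X = abs_formula (TConj I u)" "wf_tree (TConj I u)"
    "(\<lambda>i. abs_formula (u i)) ` I = X" using Conj_rep[OF assms(1)] .
  obtain J v where v: "Conj Y = abs_formula (TConj J v)" "wf_tree (TConj J v)"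
    "(\<lambda>i. abs_formula (v i)) ` J = Y" using Conj_rep[OF assms(2)] .
  show ?thesis
    using alpha_TConj_iff[OF u(2) v(2)] by (simp only: u v abs_formula_eq_iff)
qed

lemma Neg_eq_iff [simp]: "Neg A = Neg B \<longleftrightarrow> A = B"
  by transfer auto

lemma Pred_eq_iff [simp]: "(Pred \<phi> :: ('k, 'p::pt, 'a::bn) formula) = Pred \<psi> \<longleftrightarrow> \<phi> = \<psi>"
  by transfer auto

lemma formula_distinct_aux:
  "Neg A \<noteq> Pred \<phi>" "Neg A \<noteq> Act \<alpha> B" "Pred \<phi> \<noteq> Act \<alpha> B"
  by (transfer; simp)+

lemma Conj_distinct_aux:
  assumes "conjunctible X"
  shows "Conj X \<noteq> Neg A" "Conj X \<noteq> Pred \<phi>" "Conj X \<noteq> Act \<alpha> A"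
proof -
  obtain I u where u: "Conj X = abs_formula (TConj I u)" "wf_tree (TConj I u)"
    using Conj_rep[OF assms] .
  show "Conj X \<noteq> Neg A"
    using u(2) abs_formula_eq_iff[OF u(2), of "TNeg (rep_formula A)"]
    by (auto simp: u(1) abs_Neg)
  show "Conj X \<noteq> Pred \<phi>"
    using u(2) abs_formula_eq_iff[OF u(2), of "TPred \<phi>"] by (auto simp: u(1) Pred.abs_eq)
  show "Conj X \<noteq> Act \<alpha> A"
    using u(2) abs_formula_eq_iff[OF u(2), of "TAct \<alpha> (rep_formula A)"]
    by (auto simp: u(1) abs_Act)
qed

lemmas formula_distinct [simp] =
  formula_distinct_aux formula_distinct_aux[symmetric]
  Conj_distinct_aux Conj_distinct_aux[symmetric]

lemma formula_induct [case_names Conj Neg Pred Act]: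
  fixes A :: "('k, 'p::pt, 'a::bn) formula"
  assumes "\<And>X. conjunctible X \<Longrightarrow> (\<And>A. A \<in> X \<Longrightarrow> P A) \<Longrightarrow> P (Conj X)"
    and "\<And>A. P A \<Longrightarrow> P (Neg A)"
    and "\<And>\<phi>. P (Pred \<phi>)"
    and "\<And>\<alpha> A. P A \<Longrightarrow> P (Act \<alpha> A)"
  shows "P A"
proof -
  have "wf_tree t \<Longrightarrow> P (abs_formula t)" for t
  proof (induction t)
    case (TConj I u)
    show ?case
      unfolding abs_Conj[OF TConj.prems]
      by (rule assms(1)) (use TConj conjunctible_image[OF TConj.prems] in auto)
  qed (use assms in \<open>auto simp: abs_Neg abs_Act Pred.abs_eq[symmetric]\<close>)
  from this[OF wf_tree_rep[of A]] show ?thesis by simp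
qed

lemma supp_formula: "supp A = supp (Collect (alpha (rep_formula A)))"
proof -
  have "p \<bullet> A = A \<longleftrightarrow> p \<bullet> Collect (alpha (rep_formula A)) = Collect (alpha (rep_formula A))" for p
    using abs_formula_eq_iff[of "p \<bullet> rep_formula A" "rep_formula A"] abs_permute[of "rep_formula A" p]
    by (simp add: alpha_iff_same_class alpha_class_permute)
  then show ?thesis by (simp add: supp_def supports_def)
qed

lemma Act_eq_iff:
  "Act \<alpha> A = Act \<beta> B \<longleftrightarrow>
    (\<exists>p. (\<forall>a \<in> supp \<alpha> \<union> supp A - bn \<alpha>. p \<bullet> a = a) \<and> \<beta> = p \<bullet> \<alpha> \<and> B = p \<bullet> A)"
proof -
  let ?t = "rep_formula A" and ?u = "rep_formula B"
  have *: "B = p \<bullet> A \<longleftrightarrow> (\<exists>v. alpha ?t v \<and> ?u = p \<bullet> v)" for p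
  proof -
    have "B = p \<bullet> A \<longleftrightarrow> alpha (p \<bullet> ?t) ?u"
      using abs_formula_eq_iff[of "p \<bullet> ?t" ?u] abs_permute[of ?t p] by auto
    then show ?thesis by (simp add: alpha_permute_aux) (metis permute_minus_cancel)
  qed
  have "Act \<alpha> A = Act \<beta> B \<longleftrightarrow> alpha (TAct \<alpha> ?t) (TAct \<beta> ?u)"
    using abs_formula_eq_iff[of "TAct \<alpha> ?t" "TAct \<beta> ?u"] by (simp add: abs_Act)
  also have "\<dots> \<longleftrightarrow> (\<exists>p. (\<forall>a \<in> supp \<alpha> \<union> supp A - bn \<alpha>. p \<bullet> a = a) \<and> \<beta> = p \<bullet> \<alpha> \<and> B = p \<bullet> A)"
    unfolding * supp_formula[of A] by auto
  finally show ?thesis .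
qed

lemma permute_Neg [simp]: "p \<bullet> Neg A = Neg (p \<bullet> A)"
  by transfer simp

lemma permute_Pred [simp]: "p \<bullet> (Pred \<phi> :: ('k, 'p::pt, 'a::bn) formula) = Pred (p \<bullet> \<phi>)"
  by transfer simp

lemma permute_Act [simp]: "p \<bullet> Act \<alpha> A = Act (p \<bullet> \<alpha>) (p \<bullet> A)"
  using abs_permute[of "TAct \<alpha> (rep_formula A)" p] abs_permute[of "rep_formula A" p]
  by (simp add: abs_Act)

lemma permute_Conj [simp]:
  assumes "conjunctible X"
  shows "p \<bullet> Conj X = Conj (p \<bullet> X)"
proof -
  obtain I u where u: "Conj X = abs_formula (TConj I u)" "wf_tree (TConj I u)"
    "(\<lambda>i. abs_formula (u i)) ` I = X" using Conj_rep[OF assms] .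
  have wf: "wf_tree (TConj I (\<lambda>i. p \<bullet> u i))"
    using wf_tree_permute[of p "TConj I u"] u(2) by (simp del: wf_tree_permute)
  have "(\<lambda>i. abs_formula (p \<bullet> u i)) ` I = p \<bullet> X"
    using u(2) unfolding permute_set_def u(3)[symmetric] image_image
    by (intro image_cong) (auto simp: abs_permute)
  then show ?thesis
    using abs_Conj[OF wf] abs_permute[OF u(2), of p] by (simp add: u(1))
qed

lemma conjunctible_permute [simp]: "conjunctible (p \<bullet> X) \<longleftrightarrow> conjunctible X"
proof -
  have "|p \<bullet> X| =o |X|"
    by (rule card_of_ordIsoI[of "permute (- p)"])
      (auto simp: bij_betw_def inj_on_def permute_set_def image_image)
  then show ?thesis
    unfolding conjunctible_def using ordIso_ordLess_trans ordIso_symmetric by auto blast+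
qed

instance formula :: (type, fs, bn) fs
proof
  fix A :: "('a, 'b, 'c) formula"
  show "finitely_supported A"
  proof (induction A rule: formula_induct)
    case (Conj X)
    then show ?case
      unfolding conjunctible_def finitely_supported_def supports_def
      using permute_Conj[OF Conj.hyps] by metis
  next
    case (Neg A)
    then show ?case by (auto simp: finitely_supported_def supports_def)
  next
    case (Pred \<phi>)
    show ?case
      using finitely_supported[of \<phi>] by (auto simp: finitely_supported_def supports_def)
  next
    case (Act \<alpha> A)
    then obtain S R where "finite S" "supports S A" "finite R" "supports R \<alpha>"
      using finitely_supported[of \<alpha>] by (auto simp: finitely_supported_def)
    then have "finite (S \<union> R)" "supports (S \<union> R) (Act \<alpha> A)"
      by (auto simp: supports_def)
    then show ?case unfolding finitely_supported_def by blast
  qed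
qed

lemma conjunctible_if_countable:
  fixes X :: "('k, 'p::fs, 'a::bn) formula set"
  assumes "natLeq <o |UNIV :: 'k set|" "countable X" "finite S" "\<forall>A\<in>X. supports S A"
  shows "conjunctible X"
  unfolding conjunctible_def
proof
  have "|X| \<le>o natLeq"
    using assms(2) card_of_nat ordLeq_ordIso_trans
    by (metis card_of_ordLeqI countable_def UNIV_I)
  then show "|X| <o |UNIV :: 'k set|" using assms(1) ordLeq_ordLess_trans by blast
  have "supports S X"
    unfolding supports_def
  proof (intro allI impI)
    fix p assume "\<forall>a\<in>S. p \<bullet> a = a"
    then have "\<forall>A\<in>X. p \<bullet> A = A" using assms(4) by (simp add: supports_def)
    then show "p \<bullet> X = X" by (force simp: permute_set_def)
  qed
  then show "finitely_supported X" using assms(3) by (auto simp: finitely_supported_def)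
qed

section \<open>Nominal transition systems and satisfaction\<close>

text \<open>
  Predicates and actions form subsets of the respective types, since types are nonempty but a
  transition system (such as the result of \<open>S_transform\<close>) may have no state predicates. States,
  and by the presence of \<open>\<tau>\<close> also actions, raise no such problem; any nonempty nominal set of
  states is a type of class \<open>fs\<close>.
\<close>

record ('s, 'p, 'a) nts =
  preds :: "'p set"
  acts :: "'a set"
  sat :: "'s \<Rightarrow> 'p \<Rightarrow> bool"
  trans :: "'s \<Rightarrow> 'a \<Rightarrow> 's \<Rightarrow> bool"
  tau :: 'a

text \<open>
  The last condition says that the names in \<open>bn \<alpha>\<close> bind into the target state: transitions do not
  distinguish between alpha-equivalent residuals \<open>(\<alpha>, P')\<close>.
\<close>

definition nominal_ts :: "('s::fs, 'p::fs, 'a::bn) nts \<Rightarrow> bool" where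
  "nominal_ts T \<longleftrightarrow>
     (\<forall>p. \<forall>\<phi>\<in>preds T. p \<bullet> \<phi> \<in> preds T) \<and>
     (\<forall>p. \<forall>\<alpha>\<in>acts T. p \<bullet> \<alpha> \<in> acts T) \<and>
     (\<forall>P \<phi>. sat T P \<phi> \<longrightarrow> \<phi> \<in> preds T) \<and>
     (\<forall>P \<alpha> P'. trans T P \<alpha> P' \<longrightarrow> \<alpha> \<in> acts T) \<and>
     tau T \<in> acts T \<and> supp (tau T) = {} \<and>
     (\<forall>p P \<phi>. sat T P \<phi> \<longrightarrow> sat T (p \<bullet> P) (p \<bullet> \<phi>)) \<and>
     (\<forall>p P \<alpha> P'. trans T P \<alpha> P' \<longrightarrow> trans T (p \<bullet> P) (p \<bullet> \<alpha>) (p \<bullet> P')) \<and>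
     (\<forall>p P \<alpha> P'. trans T P \<alpha> P' \<and> (\<forall>a \<in> supp \<alpha> \<union> supp P' - bn \<alpha>. p \<bullet> a = a)
        \<longrightarrow> trans T P (p \<bullet> \<alpha>) (p \<bullet> P'))"

inductive subformula :: "('k, 'p::pt, 'a::bn) formula \<Rightarrow> ('k, 'p, 'a) formula \<Rightarrow> bool" where
  "conjunctible X \<Longrightarrow> A \<in> X \<Longrightarrow> subformula A (Conj X)"
| "subformula A (Neg A)"
| "subformula A (Act \<alpha> A)"

lemma wfp_subformula: "wfp (subformula :: ('k, 'p::pt, 'a::bn) formula \<Rightarrow> _)"
proof -
  have "\<forall>p. Wellfounded.accp subformula (p \<bullet> A)" for A :: "('k, 'p, 'a) formula"
  proof (induction A rule: formula_induct)
    case (Conj X)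
    show ?case
    proof (rule allI, rule accpI)
      fix p B assume "subformula B (p \<bullet> Conj X)"
      then have "B \<in> p \<bullet> X" using Conj.hyps by (cases rule: subformula.cases) auto
      then show "Wellfounded.accp subformula B"
        using Conj.IH by (auto simp: permute_set_def)
    qed
  next
    case (Neg A)
    show ?case
    proof (rule allI, rule accpI)
      fix p B assume "subformula B (p \<bullet> Neg A)"
      then have "B = p \<bullet> A" by (cases rule: subformula.cases) auto
      then show "Wellfounded.accp subformula B" using Neg by simp
    qed
  next
    case (Pred \<phi>)
    show ?case
    proof (rule allI, rule accpI)
      fix p B assume "subformula B (p \<bullet> Pred \<phi>)"
      then show "Wellfounded.accp subformula B" by (cases rule: subformula.cases) auto
    qed
  next
    case (Act \<alpha> A)
    show ?case
    proof (rule allI, rule accpI)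
      fix p B assume "subformula B (p \<bullet> Act \<alpha> A)"
      then obtain \<beta> where "Act (p \<bullet> \<alpha>) (p \<bullet> A) = Act \<beta> B"
        by (cases rule: subformula.cases) auto
      then obtain q where "B = q \<bullet> p \<bullet> A" unfolding Act_eq_iff by auto
      then show "Wellfounded.accp subformula B" using Act by (metis permute_plus)
    qed
  qed
  then show ?thesis by (metis accp_wfpI permute_zero)
qed

context
  notes conj_cong [fundef_cong]
begin

function models :: "('s::fs, 'p::fs, 'a::bn) nts \<Rightarrow> 's \<Rightarrow> ('k, 'p, 'a) formula \<Rightarrow> bool" where
  "models T P A \<longleftrightarrow>
     (\<exists>X. (conjunctible X \<and> A = Conj X) \<and> (\<forall>B\<in>X. models T P B)) \<or>
     (\<exists>B. A = Neg B \<and> \<not> models T P B) \<or>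
     (\<exists>\<phi>. A = Pred \<phi> \<and> sat T P \<phi>) \<or>
     (\<exists>\<alpha> B. A = Act \<alpha> B \<and> bn \<alpha> \<inter> supp P = {} \<and> (\<exists>P'. trans T P \<alpha> P' \<and> models T P' B))"
  by pat_completeness auto
termination
proof (relation "inv_image {(A, B). subformula A B} (\<lambda>(T, P, A). A)")
  show "wf (inv_image {(A, B). subformula A B} (\<lambda>(T, P, A). A))"
    using wfp_subformula unfolding wfp_def by (rule wf_inv_image)
qed (auto intro: subformula.intros)

end

declare models.simps [simp del]

lemma models_Conj [simp]: "conjunctible X \<Longrightarrow> models T P (Conj X) \<longleftrightarrow> (\<forall>A\<in>X. models T P A)"
  by (subst models.simps) auto

lemma models_Neg [simp]: "models T P (Neg A) \<longleftrightarrow> \<not> models T P A"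
  by (subst models.simps) auto

lemma models_Pred [simp]: "models T P (Pred \<phi> :: ('k, 'p::fs, 'a::bn) formula) \<longleftrightarrow> sat T P \<phi>"
  by (subst models.simps) auto

lemma models_Act:
  "models T P (Act \<alpha> A) \<longleftrightarrow>
    (\<exists>\<beta> B. Act \<alpha> A = Act \<beta> B \<and> bn \<beta> \<inter> supp P = {} \<and> (\<exists>P'. trans T P \<beta> P' \<and> models T P' B))"
  by (subst models.simps) auto

section \<open>Weak formulas\<close>

definition Disj :: "('k, 'p::pt, 'a::bn) formula set \<Rightarrow> ('k, 'p, 'a) formula" where
  "Disj X = Neg (Conj (Neg ` X))"

definition weak_tau :: "('s, 'p::pt, 'a::bn) nts \<Rightarrow> ('k, 'p, 'a) formula \<Rightarrow> ('k, 'p, 'a) formula" where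
  "weak_tau T A = Disj (range (\<lambda>i. (Act (tau T) ^^ i) A))"

text \<open>The disjunction in \<open>weak_tau\<close> and the conjunction in \<open>A \<and> \<phi>\<close> are genuine ones:\<close>

lemma conjunctible_weak_tau:
  fixes A :: "('k, 'p::fs, 'a::bn) formula"
  assumes "natLeq <o |UNIV :: 'k set|"
  shows "conjunctible (Neg ` range (\<lambda>i. (Act \<tau> ^^ i) A))"
proof -
  obtain S R where S: "finite S" "supports S A" and R: "finite R" "supports R \<tau>"
    using finitely_supported[of A] finitely_supported[of \<tau>] by (auto simp: finitely_supported_def)
  have "supports (S \<union> R) ((Act \<tau> ^^ i) A)" for i
    using S R by (induction i) (auto simp: supports_def)
  then have "\<forall>B \<in> Neg ` range (\<lambda>i. (Act \<tau> ^^ i) A). supports (S \<union> R) B"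
    by (auto simp: supports_def)
  then show ?thesis
    using S R by (intro conjunctible_if_countable[OF assms]) auto
qed

lemma conjunctible_insert_Pred:
  fixes A :: "('k, 'p::fs, 'a::bn) formula"
  assumes "natLeq <o |UNIV :: 'k set|"
  shows "conjunctible {A, Pred \<phi>}"
proof -
  obtain S R where S: "finite S" "supports S A"
    and R: "finite R" "supports R (Pred \<phi> :: ('k, 'p, 'a) formula)"
    using finitely_supported[of A] finitely_supported[of "Pred \<phi> :: ('k, 'p, 'a) formula"]
    by (auto simp: finitely_supported_def)
  then have "\<forall>B \<in> {A, Pred \<phi>}. supports (S \<union> R) B" by (auto simp: supports_def)
  then show ?thesis
    using S R by (intro conjunctible_if_countable[OF assms]) auto
qed

definition weak_act :: "('s, 'p::pt, 'a::bn) nts \<Rightarrow> 'a \<Rightarrow> ('k, 'p, 'a) formula \<Rightarrow> ('k, 'p, 'a) formula" where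
  "weak_act T \<alpha> A = (if \<alpha> = tau T then weak_tau T A else weak_tau T (Act \<alpha> (weak_tau T A)))"

inductive weak_formula :: "('s, 'p::pt, 'a::bn) nts \<Rightarrow> ('k, 'p, 'a) formula \<Rightarrow> bool" for T where
  "conjunctible X \<Longrightarrow> \<forall>A\<in>X. weak_formula T A \<Longrightarrow> weak_formula T (Conj X)"
| "weak_formula T A \<Longrightarrow> weak_formula T (Neg A)"
| "\<alpha> \<in> acts T \<Longrightarrow> weak_formula T A \<Longrightarrow> weak_formula T (weak_act T \<alpha> A)"
| "\<phi> \<in> preds T \<Longrightarrow> weak_formula T A \<Longrightarrow> weak_formula T (weak_tau T (Conj {A, Pred \<phi>}))"

section \<open>Replacing state predicates by self-loops\<close>

definition S_transform :: "('s, 'p, 'a) nts \<Rightarrow> ('s, 'p, 'a + 'p) nts" where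
  "S_transform T = \<lparr>
     preds = {},
     acts = acts T <+> preds T,
     sat = (\<lambda>_ _. False),
     trans = (\<lambda>P \<alpha>' P'. case \<alpha>' of Inl \<alpha> \<Rightarrow> trans T P \<alpha> P' | Inr \<phi> \<Rightarrow> P' = P \<and> sat T P \<phi>),
     tau = Inl (tau T)\<rparr>"

lemma nominal_ts_S_transform:
  assumes "nominal_ts T"
  shows "nominal_ts (S_transform T)"
proof -
  have "p \<bullet> P = P" "p \<bullet> \<phi> = \<phi>" if "\<forall>a\<in>supp \<phi> \<union> supp P. p \<bullet> a = a"
    for p and P :: 'a and \<phi> :: 'b
    using that by (simp_all add: permute_eq_if_supp_fixed)
  then show ?thesis
    using assms unfolding nominal_ts_def S_transform_def
    by (auto simp: bn_sum_def split: sum.splits) (metis InlI InrI obj_sumE)+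
qed

end

theory Submission
  imports Defs
begin

text \<open>
  The formula \<open>\<langle>\<langle>\<phi>\<rangle>\<rangle>A\<close> over \<open>S_transform T\<close> is not equivalent to \<open>\<langle>\<langle>\<tau>\<rangle>\<rangle>(A \<and> \<phi>)\<close>, because \<open>A\<close> may hold
  only after further silent steps, so there is no direct syntactic translation. Instead, the weak
  logic is expressively complete: every finitely supported set of states that is closed under weak
  logical equivalence is defined by a weak formula, since there are fewer than \<open>\<kappa>\<close> states and only
  countably many permutations. It thus suffices that the set of states satisfying
  \<open>\<langle>\<langle>\<tau>\<rangle>\<rangle>(A \<and> \<phi>)\<close> is closed under weak equivalence in \<open>S_transform T\<close>. This follows from
  stuttering: if \<open>P \<Rightarrow> Q \<Rightarrow> R\<close> and \<open>P\<close>, \<open>R\<close> are weakly equivalent, then so are \<open>P\<close>, \<open>Q\<close>.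
  Expressive completeness also handles conjunctions, for which translations chosen separately for
  the conjuncts need not form a finitely supported set.
\<close>

section \<open>Permutations\<close>

text \<open>A permutation is determined by its graph on the names that it moves. This graph is a
  finite set of pairs of names, and a countable set has only countably many finite subsets.\<close>

lemma countable_perm: "countable (UNIV :: perm set)"
proof -
  have eq: "p = q" if "{(a :: name, p \<bullet> a) |a. p \<bullet> a \<noteq> a} = {(a, q \<bullet> a) |a. q \<bullet> a \<noteq> a}" for p q :: perm
  proof -
    have "p \<bullet> a = q \<bullet> a" for a :: name
      using that unfolding set_eq_iff by simp metis
    then show ?thesis
      by (metis apply_perm_inject ext permute_name_def)
  qed
  have "countable (UNIV :: name set)"
    by (rule countableI'[of "\<lambda>a. prod_encode (sort_of a, index_of a)"])
      (auto intro!: injI simp: name.expand)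
  then have "countable (UNIV :: (name \<times> name) set)"
    by (metis UNIV_Times_UNIV countable_SIGMA)
  then have "countable {G :: (name \<times> name) set. finite G}"
    using countable_Collect_finite_subset by (metis (mono_tags) Collect_cong subset_UNIV)
  moreover have "range (\<lambda>p :: perm. {(a :: name, p \<bullet> a) |a. p \<bullet> a \<noteq> a}) \<subseteq> {G. finite G}"
  proof clarsimp
    fix p :: perm
    have "finite {a :: name. p \<bullet> a \<noteq> a}"
      using apply_perm[of p] by (simp add: permute_name_def)
    then show "finite {(a :: name, p \<bullet> a) |a. p \<bullet> a \<noteq> a}" by simp
  qed
  ultimately show ?thesis
    using eq by (meson countable_image_inj_on countable_subset injI)
qed

lemma permute_eq_if_agree_on_supp:
  fixes x :: "'a::fs"
  assumes "\<forall>a\<in>supp x. p \<bullet> a = q \<bullet> a"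
  shows "p \<bullet> x = q \<bullet> x"
proof -
  have "(- q + p) \<bullet> x = x"
    by (rule permute_eq_if_supp_fixed) (use assms in \<open>simp add: permute_plus\<close>)
  then have "q \<bullet> (- q + p) \<bullet> x = q \<bullet> x" by simp
  then show ?thesis by (simp add: permute_plus)
qed

lemma finite_supp: "finite (supp (x :: 'a::fs))"
  by (rule finitely_supported_supp(1)[OF finitely_supported])

lemma finite_bn: "finite (bn (\<alpha> :: 'a::bn))"
  by (rule finite_subset[OF bn_subset_supp finite_supp])

text \<open>The witness exchanges \<open>A\<close> and \<open>s \<bullet> A\<close>, using
  \<open>s\<close> one way and its inverse the other. Disjointness of the two sets makes it an
  involution; it fixes \<open>N - A\<close> because \<open>s \<bullet> A\<close> misses
  \<open>N\<close>.\<close>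

lemma obtain_perm_extending:
  fixes A N :: "name set" and s :: perm
  assumes "finite A" "(s \<bullet> A) \<inter> (A \<union> N) = {}"
  obtains r where "\<forall>a\<in>A. r \<bullet> a = s \<bullet> a" "\<forall>a\<in>N - A. r \<bullet> a = a"
proof -
  define f where "f a = (if a \<in> A then s \<bullet> a else if a \<in> s \<bullet> A then - s \<bullet> a else a)" for a :: name
  have ff: "f (f a) = a" for a
  proof -
    have "s \<bullet> a \<notin> A" if "a \<in> A" using assms(2) that mem_permute_iff[of s a A] by blast
    then show ?thesis by (auto simp: f_def mem_permute_iff')
  qed
  have "bij f" by (rule o_bij[of f]) (auto simp: ff)
  moreover have "finite {a. f a \<noteq> a}"
    by (rule finite_subset[of _ "A \<union> s \<bullet> A"]) (auto simp: f_def assms(1))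
  moreover have "sort_of (p \<bullet> a) = sort_of a" for p and a :: name
    using apply_perm[of p] by (simp add: permute_name_def)
  then have "sort_of (f a) = sort_of a" for a by (simp add: f_def)
  ultimately have f: "apply_perm (Perm f) = f" by (simp add: Perm_inverse)
  show thesis
    by (rule that[of "Perm f"]) (use assms(2) in \<open>auto simp: permute_name_def[of "Perm f"] f f_def\<close>)
qed

section \<open>Equivariance\<close>

lemma nominal_ts_trans_permute:
  assumes "nominal_ts T" "trans T P \<alpha> P'"
  shows "trans T (p \<bullet> P) (p \<bullet> \<alpha>) (p \<bullet> P')"
  using assms unfolding nominal_ts_def by blast

lemma nominal_ts_sat_iff:
  assumes "nominal_ts T"
  shows "sat T (p \<bullet> P) (p \<bullet> \<phi>) \<longleftrightarrow> sat T P \<phi>"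
  using assms unfolding nominal_ts_def by (metis permute_minus_cancel(2))

lemma nominal_ts_trans_alpha:
  assumes "nominal_ts T" "trans T P \<alpha> P'" "\<forall>a \<in> supp \<alpha> \<union> supp P' - bn \<alpha>. p \<bullet> a = a"
  shows "trans T P (p \<bullet> \<alpha>) (p \<bullet> P')"
  using assms unfolding nominal_ts_def by blast

lemma permute_tau:
  assumes "nominal_ts T"
  shows "p \<bullet> tau T = tau T"
  using assms by (auto simp: nominal_ts_def intro: permute_eq_if_supp_fixed)

text \<open>The assumption on \<open>A\<close> ranges over all permutations because satisfaction
  picks an alpha-variant, whose body is some \<open>q \<bullet> A\<close>.\<close>

lemma models_permute_Act:
  assumes "nominal_ts T"
    and "\<forall>p P. models T (p \<bullet> P) (p \<bullet> A) \<longleftrightarrow> models T P A"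
    and "models T P (Act \<alpha> A)"
  shows "models T (p \<bullet> P) (p \<bullet> Act \<alpha> A)"
proof -
  obtain \<beta> B P' where B: "Act \<alpha> A = Act \<beta> B" "bn \<beta> \<inter> supp P = {}" "trans T P \<beta> P'" "models T P' B"
    using assms(3) unfolding models_Act by blast
  obtain q where q: "B = q \<bullet> A" using B(1) unfolding Act_eq_iff by auto
  have "models T (- q \<bullet> P') A"
    using B(4) assms(2) q by (metis permute_minus_cancel(1))
  then have "models T ((p + q) \<bullet> - q \<bullet> P') ((p + q) \<bullet> A)"
    using assms(2) by blast
  then have "models T (p \<bullet> P') (p \<bullet> B)"
    by (simp add: q permute_plus)
  moreover have "bn (p \<bullet> \<beta>) \<inter> supp (p \<bullet> P) = {}"
    using B(2) by (auto simp: bn_eqvt supp_eqvt mem_permute_iff')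
  moreover have "p \<bullet> Act \<alpha> A = Act (p \<bullet> \<beta>) (p \<bullet> B)"
    using B(1) by simp
  ultimately show ?thesis
    using nominal_ts_trans_permute[OF assms(1) B(3), of p] by (metis models_Act permute_Act)
qed

lemma models_permute_iff:
  fixes A :: "('k, 'p::fs, 'a::bn) formula"
  assumes "nominal_ts T"
  shows "models T (p \<bullet> P) (p \<bullet> A) \<longleftrightarrow> models T P A"
proof (induction A arbitrary: p P rule: formula_induct)
  case (Conj X)
  then show ?case by (simp add: permute_set_def[of p X, symmetric]) (auto simp: permute_set_def)
next
  case (Pred \<phi>)
  then show ?case by (simp add: nominal_ts_sat_iff[OF assms])
next
  case (Act \<alpha> A)
  have IH: "\<forall>p P. models T (p \<bullet> P) (p \<bullet> A) \<longleftrightarrow> models T P A" using Act by blast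
  \<comment> \<open>The converse implication uses \<open>models_permute_Act\<close> for
    \<open>- p\<close> and \<open>p \<bullet> A\<close>, so equivariance is also needed for
    \<open>p \<bullet> A\<close>.\<close>
  have IH': "\<forall>q P. models T (q \<bullet> P) (q \<bullet> p \<bullet> A) \<longleftrightarrow> models T P (p \<bullet> A)"
  proof (intro allI)
    fix q P
    have "models T (q \<bullet> P) (q \<bullet> p \<bullet> A) \<longleftrightarrow> models T ((q + p) \<bullet> - p \<bullet> P) ((q + p) \<bullet> A)"
      by (simp add: permute_plus)
    also have "\<dots> \<longleftrightarrow> models T (- p \<bullet> P) A" using IH by blast
    also have "\<dots> \<longleftrightarrow> models T (p \<bullet> - p \<bullet> P) (p \<bullet> A)" using IH by blast
    finally show "models T (q \<bullet> P) (q \<bullet> p \<bullet> A) \<longleftrightarrow> models T P (p \<bullet> A)" by simp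
  qed
  show ?case
    using models_permute_Act[OF assms IH, of P \<alpha> p]
      models_permute_Act[OF assms IH', of "p \<bullet> P" "p \<bullet> \<alpha>" "- p"] by auto
qed simp

lemma models_permute_right:
  fixes A :: "('k, 'p::fs, 'a::bn) formula"
  assumes "nominal_ts T"
  shows "models T P (p \<bullet> A) \<longleftrightarrow> models T (- p \<bullet> P) A"
  using models_permute_iff[OF assms, of p "- p \<bullet> P" A] by simp

lemma permute_Neg_image: "p \<bullet> (Neg ` X) = Neg ` (p \<bullet> X)"
  by (simp add: permute_set_def image_image)

lemma permute_weak_tau:
  fixes A :: "('k, 'p::fs, 'a::bn) formula"
  assumes "nominal_ts T" "natLeq <o |UNIV :: 'k set|"
  shows "p \<bullet> weak_tau T A = weak_tau T (p \<bullet> A)"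
proof -
  have "p \<bullet> (Act (tau T) ^^ i) A = (Act (tau T) ^^ i) (p \<bullet> A)" for i
    by (induction i) (simp_all add: permute_tau[OF assms(1)])
  then have "p \<bullet> range (\<lambda>i. (Act (tau T) ^^ i) A) = range (\<lambda>i. (Act (tau T) ^^ i) (p \<bullet> A))"
    by (simp add: permute_set_def image_image)
  then show ?thesis
    using conjunctible_weak_tau[OF assms(2), of "tau T" A]
    by (simp add: weak_tau_def Disj_def permute_Neg_image)
qed

lemma permute_weak_act:
  fixes A :: "('k, 'p::fs, 'a::bn) formula"
  assumes "nominal_ts T" "natLeq <o |UNIV :: 'k set|"
  shows "p \<bullet> weak_act T \<alpha> A = weak_act T (p \<bullet> \<alpha>) (p \<bullet> A)"
proof -
  have "p \<bullet> \<alpha> = tau T \<longleftrightarrow> \<alpha> = tau T"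
    using permute_tau[OF assms(1)] permute_eq_iff by metis
  then show ?thesis by (simp add: weak_act_def permute_weak_tau[OF assms])
qed

lemma weak_formula_permute:
  fixes A :: "('k, 'p::fs, 'a::bn) formula"
  assumes "nominal_ts T" "natLeq <o |UNIV :: 'k set|" "weak_formula T A"
  shows "weak_formula T (p \<bullet> A)"
  using assms(3)
proof induction
  case (1 X)
  then have "\<forall>A\<in>p \<bullet> X. weak_formula T A" by (auto simp: permute_set_def)
  then show ?case using 1(1) by (simp add: weak_formula.intros(1))
next
  case (2 A)
  then show ?case by (simp add: weak_formula.intros)
next
  case (3 \<alpha> A)
  then have "p \<bullet> \<alpha> \<in> acts T" using assms(1) by (simp add: nominal_ts_def)
  then show ?case using 3 by (simp add: permute_weak_act[OF assms(1,2)] weak_formula.intros)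
next
  case (4 \<phi> A)
  have "p \<bullet> Conj {A, Pred \<phi>} = Conj {p \<bullet> A, Pred (p \<bullet> \<phi>)}"
    using conjunctible_insert_Pred[OF assms(2), of A \<phi>] by (simp add: permute_set_def)
  moreover have "p \<bullet> \<phi> \<in> preds T" using 4 assms(1) by (simp add: nominal_ts_def)
  ultimately show ?case using 4 by (simp add: permute_weak_tau[OF assms(1,2)] weak_formula.intros)
qed

section \<open>Satisfaction of modalities\<close>

text \<open>
  The alpha-variant can be chosen by a renaming that fixes any further finite set of names, so that
  \<open>Act \<alpha> A\<close> and \<open>Act \<alpha> A'\<close> can be compared when \<open>A\<close> and \<open>A'\<close> have different supports.
\<close>

lemma models_Act_fresh:
  fixes A :: "('k, 'p::fs, 'a::bn) formula"
  assumes T: "nominal_ts T" and N: "finite N" "supp \<alpha> \<union> supp A \<subseteq> N"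
  shows "models T P (Act \<alpha> A) \<longleftrightarrow> (\<exists>p P'. (\<forall>a\<in>N - bn \<alpha>. p \<bullet> a = a) \<and>
    bn (p \<bullet> \<alpha>) \<inter> supp P = {} \<and> trans T P (p \<bullet> \<alpha>) P' \<and> models T P' (p \<bullet> A))"
    (is "_ \<longleftrightarrow> ?R")
proof
  assume ?R
  then obtain p P' where p: "\<forall>a\<in>N - bn \<alpha>. p \<bullet> a = a" "bn (p \<bullet> \<alpha>) \<inter> supp P = {}"
    "trans T P (p \<bullet> \<alpha>) P'" "models T P' (p \<bullet> A)" by blast
  have "Act \<alpha> A = Act (p \<bullet> \<alpha>) (p \<bullet> A)"
    unfolding Act_eq_iff using p(1) N(2) by blast
  then show "models T P (Act \<alpha> A)"
    unfolding models_Act[of T P \<alpha>] using p by blast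
next
  assume "models T P (Act \<alpha> A)"
  then obtain \<beta> B P' where B: "Act \<alpha> A = Act \<beta> B" "bn \<beta> \<inter> supp P = {}" "trans T P \<beta> P'" "models T P' B"
    unfolding models_Act by blast
  then obtain p where p: "\<forall>a \<in> supp \<alpha> \<union> supp A - bn \<alpha>. p \<bullet> a = a" "\<beta> = p \<bullet> \<alpha>" "B = p \<bullet> A"
    unfolding Act_eq_iff by blast
  let ?C = "supp \<beta> \<union> supp P' \<union> supp B - bn \<beta>"
  \<comment> \<open>\<open>q\<close> moves the binders of \<open>\<beta>\<close> away from
    \<open>N\<close> and \<open>P\<close>. As it fixes \<open>?C\<close>, it changes the residual of
    the transition and \<open>Act \<beta> B\<close> only up to alpha-equivalence.\<close>
  obtain q where q: "(q \<bullet> bn \<beta>) \<inter> (N \<union> supp P \<union> ?C) = {}" "\<forall>a\<in>?C. q \<bullet> a = a"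
    by (rule obtain_fresh_perm[of "bn \<beta>" "N \<union> supp P \<union> ?C" ?C])
      (use N in \<open>auto simp: finite_bn finite_supp\<close>)
  let ?s = "q + p"
  have bn_s: "?s \<bullet> bn \<alpha> = q \<bullet> bn \<beta>" by (simp add: permute_plus p(2) bn_eqvt)
  have sub: "bn \<alpha> \<subseteq> N" using bn_subset_supp N(2) by blast
  have "(?s \<bullet> bn \<alpha>) \<inter> (bn \<alpha> \<union> N) = {}" using q(1) sub unfolding bn_s by blast
  \<comment> \<open>\<open>?s\<close> may move names of \<open>N\<close> that are not free in
    \<open>Act \<alpha> A\<close>. It is replaced by an \<open>r\<close> that agrees with it on
    \<open>supp \<alpha> \<union> supp A\<close> and fixes all of
    \<open>N - bn \<alpha>\<close>.\<close>
  then obtain r where r: "\<forall>a\<in>bn \<alpha>. r \<bullet> a = ?s \<bullet> a" "\<forall>a\<in>N - bn \<alpha>. r \<bullet> a = a"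
    using obtain_perm_extending[OF finite_bn] by blast
  have "?s \<bullet> a = a" if a: "a \<in> supp \<alpha> \<union> supp A - bn \<alpha>" for a
  proof -
    have pa: "p \<bullet> a = a" using p(1) a by blast
    have "a \<in> supp \<beta> \<union> supp B" "a \<notin> bn \<beta>"
      using a mem_permute_iff[of p a] pa unfolding p(2,3) supp_eqvt bn_eqvt by auto
    then have "q \<bullet> a = a" using q(2) by blast
    then show ?thesis using pa by (simp add: permute_plus)
  qed
  then have agree: "\<forall>a \<in> supp \<alpha> \<union> supp A. r \<bullet> a = ?s \<bullet> a"
    using r N(2) by (metis (no_types, lifting) DiffI subsetD)
  then have rs: "r \<bullet> \<alpha> = q \<bullet> \<beta>" "r \<bullet> A = q \<bullet> B"
    using permute_eq_if_agree_on_supp[of \<alpha> r ?s] permute_eq_if_agree_on_supp[of A r ?s]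
    by (simp_all add: p(2,3) permute_plus)
  have "trans T P (q \<bullet> \<beta>) (q \<bullet> P')"
    by (rule nominal_ts_trans_alpha[OF T B(3)]) (use q(2) in blast)
  moreover have "models T (q \<bullet> P') (q \<bullet> B)" using B(4) by (simp add: models_permute_iff[OF T])
  moreover have "bn (q \<bullet> \<beta>) \<inter> supp P = {}" using q(1) by (auto simp: bn_eqvt)
  ultimately show ?R using r(2) unfolding rs[symmetric] by blast
qed

definition tau_steps :: "('s, 'p, 'a) nts \<Rightarrow> 's \<Rightarrow> 's \<Rightarrow> bool" where
  "tau_steps T = (\<lambda>P P'. trans T P (tau T) P')\<^sup>*\<^sup>*"

text \<open>The action \<open>tau T\<close> has empty support, so it binds nothing and
  \<open>Act (tau T) A\<close> has no alpha-variant but itself.\<close>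

lemma models_Act_tau:
  fixes A :: "('k, 'p::fs, 'a::bn) formula"
  assumes "nominal_ts T"
  shows "models T P (Act (tau T) A) \<longleftrightarrow> (\<exists>P'. trans T P (tau T) P' \<and> models T P' A)"
proof -
  have "supp (tau T) = {}" using assms by (simp add: nominal_ts_def)
  then have bn: "bn (tau T) = {}" using bn_subset_supp[of "tau T"] by simp
  have "Act (tau T) A = Act \<beta> B \<longleftrightarrow> \<beta> = tau T \<and> B = A" for \<beta> B
    unfolding Act_eq_iff using permute_tau[OF assms] permute_eq_if_supp_fixed[of A] bn
    by (auto intro: exI[of _ 0])
  then show ?thesis unfolding models_Act[of T P "tau T" A] using bn by auto
qed

lemma models_weak_tau:
  fixes A :: "('k, 'p::fs, 'a::bn) formula"
  assumes "nominal_ts T" "natLeq <o |UNIV :: 'k set|"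
  shows "models T P (weak_tau T A) \<longleftrightarrow> (\<exists>P'. tau_steps T P P' \<and> models T P' A)"
proof -
  let ?r = "\<lambda>P P'. trans T P (tau T) P'"
  have "models T P ((Act (tau T) ^^ i) A) \<longleftrightarrow> (\<exists>P'. (?r ^^ i) P P' \<and> models T P' A)" for i
  proof (induction i arbitrary: P)
    case (Suc i)
    show ?case
      unfolding funpow.simps(2) comp_def models_Act_tau[OF assms(1)] Suc.IH
      by (blast dest: relpowp_Suc_D2 intro: relpowp_Suc_I2)
  qed simp
  then show ?thesis
    using conjunctible_weak_tau[OF assms(2), of "tau T" A]
    unfolding weak_tau_def Disj_def tau_steps_def rtranclp_power by auto
qed

text \<open>Lets the stuttering argument treat all modal weak formulas alike, as formulas that start
  with a silent diamond.\<close>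

lemma weak_act_is_weak_tau: "\<exists>B. weak_act T \<alpha> A = weak_tau T B"
  by (auto simp: weak_act_def)

section \<open>Weak logical equivalence\<close>

text \<open>The first argument only carries the type \<open>'k\<close> for \<kappa>, which occurs in
  the quantified formulas alone and is not determined by the other arguments.\<close>

definition weak_equiv :: "'k itself \<Rightarrow> ('s::fs, 'p::fs, 'a::bn) nts \<Rightarrow> 's \<Rightarrow> 's \<Rightarrow> bool" where
  "weak_equiv _ T P Q \<longleftrightarrow>
    (\<forall>A :: ('k, 'p, 'a) formula. weak_formula T A \<longrightarrow> (models T P A \<longleftrightarrow> models T Q A))"

lemma weak_equivD:
  fixes A :: "('k, 'p::fs, 'a::bn) formula"
  assumes "weak_equiv TYPE('k) T P Q" "weak_formula T A"
  shows "models T P A \<longleftrightarrow> models T Q A"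
  using assms by (simp add: weak_equiv_def)

lemma weak_equiv_sym: "weak_equiv K T P Q \<Longrightarrow> weak_equiv K T Q P"
  by (simp add: weak_equiv_def)

lemma weak_equiv_trans: "weak_equiv K T P Q \<Longrightarrow> weak_equiv K T Q R \<Longrightarrow> weak_equiv K T P R"
  by (simp add: weak_equiv_def)

text \<open>A formula \<open>weak_tau T B\<close> that holds after silent steps also holds before
  them. Truth thus passes from \<open>R\<close> to \<open>Q\<close> and from \<open>Q\<close> to
  \<open>P\<close>, and agreement of \<open>P\<close> and \<open>R\<close> closes the circle. Every
  modal weak formula has this shape; conjunction and negation follow by induction.\<close>

lemma weak_equiv_stuttering:
  fixes T :: "('s::fs, 'p::fs, 'a::bn) nts"
  assumes T: "nominal_ts T" and k: "natLeq <o |UNIV :: 'k set|"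
    and steps: "tau_steps T P Q" "tau_steps T Q R"
    and equiv: "weak_equiv TYPE('k) T P R"
  shows "weak_equiv TYPE('k) T P Q"
proof -
  have *: "models T P (weak_tau T B) \<longleftrightarrow> models T Q (weak_tau T B)"
    if "weak_formula T (weak_tau T B)" for B :: "('k, 'p, 'a) formula"
    using weak_equivD[OF equiv that] steps unfolding models_weak_tau[OF T k] tau_steps_def
    by (meson rtranclp_trans)
  have "models T P A \<longleftrightarrow> models T Q A" if "weak_formula T A" for A :: "('k, 'p, 'a) formula"
    using that
  proof induction
    case (3 \<alpha> A)
    then show ?case using * weak_act_is_weak_tau by (metis weak_formula.intros(3))
  next
    case (4 \<phi> A)
    then show ?case using * by (metis weak_formula.intros(4))
  qed simp_all
  then show ?thesis by (simp add: weak_equiv_def)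
qed

section \<open>Expressive completeness\<close>

text \<open>Repairs families of formulas picked by choice, which need not be finitely supported: the
  closure is supported by \<open>N\<close>, and it stays small because there are only countably many
  permutations.\<close>

definition orbits :: "name set \<Rightarrow> 'a::pt set \<Rightarrow> 'a set" where
  "orbits N X = {p \<bullet> x |p x. x \<in> X \<and> (\<forall>a\<in>N. p \<bullet> a = a)}"

lemma subset_orbits: "X \<subseteq> orbits N X"
  unfolding orbits_def by (force intro: exI[of _ 0])

lemma supports_orbits: "supports N (orbits N X)"
proof -
  have *: "p \<bullet> orbits N X \<subseteq> orbits N X" if p: "\<forall>a\<in>N. p \<bullet> a = a" for p
  proof
    fix y assume "y \<in> p \<bullet> orbits N X"
    then obtain q x where "y = (p + q) \<bullet> x" "x \<in> X" "\<forall>a\<in>N. q \<bullet> a = a"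
      by (auto simp: orbits_def permute_set_def permute_plus)
    moreover from this p have "\<forall>a\<in>N. (p + q) \<bullet> a = a" by (simp add: permute_plus)
    ultimately show "y \<in> orbits N X" unfolding orbits_def by blast
  qed
  show ?thesis
    unfolding supports_def
  proof (intro allI impI antisym)
    fix p assume p: "\<forall>a\<in>N. p \<bullet> a = a"
    then show "p \<bullet> orbits N X \<subseteq> orbits N X" by (rule *)
    have "\<forall>a\<in>N. - p \<bullet> a = a" using p by (metis permute_minus_cancel(2))
    then have "- p \<bullet> orbits N X \<subseteq> orbits N X" by (rule *)
    then show "orbits N X \<subseteq> p \<bullet> orbits N X"
      by (metis mem_permute_iff mem_permute_iff' subset_eq)
  qed
qed

text \<open>The set is an image of the product of \<open>X\<close> with the countable set of
  permutations, so its cardinality is at most the larger of \<open>natLeq\<close> and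
  \<open>|X|\<close>, both below \<kappa>.\<close>

lemma conjunctible_orbits:
  fixes X :: "('k, 'p::pt, 'a::bn) formula set"
  assumes k: "natLeq <o |UNIV :: 'k set|" and X: "|X| <o |UNIV :: 'k set|" and N: "finite N"
  shows "conjunctible (orbits N X)"
  unfolding conjunctible_def
proof
  have perm: "|UNIV :: perm set| \<le>o natLeq"
    using countable_perm card_of_nat ordLeq_ordIso_trans
    by (metis card_of_ordLeqI countable_def UNIV_I)
  have "orbits N X \<subseteq> (\<lambda>(p, x). p \<bullet> x) ` (UNIV \<times> X)" unfolding orbits_def by auto
  then have "|orbits N X| \<le>o |(UNIV :: perm set) \<times> X|" by (rule surj_imp_ordLeq)
  moreover have "|(UNIV :: perm set) \<times> X| <o |UNIV :: 'k set|"
  proof (cases "|X| \<le>o natLeq")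
    case True
    then have "|(UNIV :: perm set) \<times> X| \<le>o natLeq"
      by (intro card_of_Times_ordLeq_infinite_Field perm natLeq_Card_order) (simp add: Field_natLeq)
    then show ?thesis using k by (rule ordLeq_ordLess_trans)
  next
    case False
    then have "natLeq \<le>o |X|"
      using natLeq_Well_order card_of_Well_order ordLeq_total by blast
    moreover from this have "infinite X" using infinite_iff_natLeq_ordLeq by blast
    ultimately have "|(UNIV :: perm set) \<times> X| \<le>o |X|"
      by (intro card_of_Times_ordLeq_infinite_Field ordLeq_transitive[OF perm] card_of_Card_order)
        (simp_all add: card_of_refl ordIso_imp_ordLeq Field_card_of)
    then show ?thesis using X by (rule ordLeq_ordLess_trans)
  qed
  ultimately show "|orbits N X| <o |UNIV :: 'k set|" by (rule ordLeq_ordLess_trans)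
  show "finitely_supported (orbits N X)"
    using N supports_orbits unfolding finitely_supported_def by blast
qed

lemma weak_formula_Conj_orbits:
  fixes X :: "('k, 'p::fs, 'a::bn) formula set"
  assumes "nominal_ts T" "natLeq <o |UNIV :: 'k set|" "|X| <o |UNIV :: 'k set|" "finite N"
    and "\<forall>A\<in>X. weak_formula T A"
  shows "weak_formula T (Conj (orbits N X))"
proof (rule weak_formula.intros(1))
  show "conjunctible (orbits N X)" by (rule conjunctible_orbits[OF assms(2-4)])
  show "\<forall>A\<in>orbits N X. weak_formula T A"
    using assms(5) weak_formula_permute[OF assms(1,2)] by (auto simp: orbits_def)
qed

text \<open>Each state not equivalent to \<open>P\<close> is separated from it by a weak formula,
  which may be taken to hold at \<open>P\<close> by negating it if necessary. The conjunction of
  these formulas characterises the class. Adding their copies under permutations fixing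
  \<open>supp P\<close> is harmless, since such permutations fix \<open>P\<close>.\<close>

lemma characteristic_weak_formula:
  fixes T :: "('s::fs, 'p::fs, 'a::bn) nts"
  assumes T: "nominal_ts T" and k: "natLeq <o |UNIV :: 'k set|" "|UNIV :: 's set| <o |UNIV :: 'k set|"
  obtains C :: "('k, 'p, 'a) formula"
    where "weak_formula T C" "\<And>Q. models T Q C \<longleftrightarrow> weak_equiv TYPE('k) T P Q"
proof -
  have "\<exists>A :: ('k, 'p, 'a) formula. weak_formula T A \<and> models T P A \<and> \<not> models T Q A"
    if "\<not> weak_equiv TYPE('k) T P Q" for Q
    using that unfolding weak_equiv_def by (metis models_Neg weak_formula.intros(2))
  then obtain D :: "'s \<Rightarrow> ('k, 'p, 'a) formula" where D:
    "\<And>Q. \<not> weak_equiv TYPE('k) T P Q \<Longrightarrow> weak_formula T (D Q) \<and> models T P (D Q) \<and> \<not> models T Q (D Q)"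
    by metis
  let ?X = "D ` {Q. \<not> weak_equiv TYPE('k) T P Q}"
  let ?Y = "orbits (supp P) ?X"
  have X: "|?X| <o |UNIV :: 'k set|"
    using surj_imp_ordLeq[of ?X D UNIV] k(2) ordLeq_ordLess_trans by blast
  have weak: "weak_formula T (Conj ?Y)"
    by (rule weak_formula_Conj_orbits[OF T k(1) X finite_supp]) (use D in auto)
  have conj: "models T Q (Conj ?Y) \<longleftrightarrow> (\<forall>A\<in>?Y. models T Q A)" for Q
    by (rule models_Conj[OF conjunctible_orbits[OF k(1) X finite_supp]])
  have P: "models T P (Conj ?Y)"
    unfolding conj
  proof
    fix A assume "A \<in> ?Y"
    then obtain p Q where A: "A = p \<bullet> D Q" "\<not> weak_equiv TYPE('k) T P Q" "\<forall>a\<in>supp P. p \<bullet> a = a"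
      by (auto simp: orbits_def)
    then have "p \<bullet> P = P" by (simp add: permute_eq_if_supp_fixed)
    then show "models T P A" using D[OF A(2)] models_permute_iff[OF T, of p P "D Q"] A(1) by simp
  qed
  have "weak_equiv TYPE('k) T P Q" if "models T Q (Conj ?Y)" for Q
  proof (rule ccontr)
    assume Q: "\<not> weak_equiv TYPE('k) T P Q"
    then have "D Q \<in> ?Y" using subset_orbits[of ?X] by blast
    then show False using D[OF Q] that conj by blast
  qed
  then show thesis using that[OF weak] P weak_equivD[OF _ weak] by blast
qed

text \<open>A closed set is a union of equivalence classes, so the disjunction of the characteristic
  formulas of its members defines it.\<close>

lemma expressive_completeness:
  fixes T :: "('s::fs, 'p::fs, 'a::bn) nts"
  assumes T: "nominal_ts T" and k: "natLeq <o |UNIV :: 'k set|" "|UNIV :: 's set| <o |UNIV :: 'k set|"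
    and S: "finitely_supported S" "\<And>P Q. P \<in> S \<Longrightarrow> weak_equiv TYPE('k) T P Q \<Longrightarrow> Q \<in> S"
  shows "\<exists>A :: ('k, 'p, 'a) formula. weak_formula T A \<and> (\<forall>P. models T P A \<longleftrightarrow> P \<in> S)"
proof -
  obtain N where N: "finite N" "supports N S" using S(1) by (auto simp: finitely_supported_def)
  have "\<exists>C :: ('k, 'p, 'a) formula. weak_formula T C \<and> (\<forall>Q. models T Q C \<longleftrightarrow> weak_equiv TYPE('k) T P Q)"
    for P using characteristic_weak_formula[OF T k] by metis
  then obtain C :: "'s \<Rightarrow> ('k, 'p, 'a) formula" where
    C: "\<And>P. weak_formula T (C P)" "\<And>P Q. models T Q (C P) \<longleftrightarrow> weak_equiv TYPE('k) T P Q"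
    by metis
  let ?X = "(\<lambda>P. Neg (C P)) ` S"
  let ?Y = "orbits N ?X"
  have X: "|?X| <o |UNIV :: 'k set|"
    using surj_imp_ordLeq[of ?X "\<lambda>P. Neg (C P)" UNIV] k(2) ordLeq_ordLess_trans by blast
  have weak: "weak_formula T (Neg (Conj ?Y))"
    by (intro weak_formula.intros(2) weak_formula_Conj_orbits[OF T k(1) X N(1)])
      (auto intro: C weak_formula.intros(2))
  have "models T R (Neg (Conj ?Y)) \<longleftrightarrow> R \<in> S" for R
  proof -
    have *: "models T R (Neg (Conj ?Y)) \<longleftrightarrow> (\<exists>A\<in>?Y. \<not> models T R A)"
      by (simp add: models_Conj[OF conjunctible_orbits[OF k(1) X N(1)]])
    show ?thesis
    proof
      assume "R \<in> S"
      then have "Neg (C R) \<in> ?Y" using subset_orbits[of ?X] by blast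
      moreover have "models T R (C R)" by (simp add: C weak_equiv_def)
      ultimately show "models T R (Neg (Conj ?Y))" unfolding * by force
    next
      assume "models T R (Neg (Conj ?Y))"
      then obtain p P where p: "P \<in> S" "\<forall>a\<in>N. p \<bullet> a = a" "\<not> models T R (p \<bullet> Neg (C P))"
        unfolding * unfolding orbits_def by auto
      \<comment> \<open>A permuted disjunct \<open>p \<bullet> C P\<close> adds no states: it holds
        at \<open>R\<close> only if \<open>- p \<bullet> R\<close> is equivalent to
        \<open>P\<close>, which puts \<open>R\<close> in \<open>p \<bullet> S = S\<close>.\<close>
      then have "weak_equiv TYPE('k) T P (- p \<bullet> R)"
        unfolding models_permute_right[OF T] by (simp add: C)
      then have "R \<in> p \<bullet> S" using S(2)[OF p(1)] by (simp add: mem_permute_iff')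
      then show "R \<in> S" using N(2) p(2) by (simp add: supports_def)
    qed
  qed
  then show ?thesis using weak by blast
qed

section \<open>Translation\<close>

lemma finitely_supported_models:
  fixes A :: "('k, 'p::fs, 'a::bn) formula"
  assumes "nominal_ts T"
  shows "finitely_supported {P. models T P A}"
  unfolding finitely_supported_def
proof (intro exI conjI)
  show "finite (supp A)" by (rule finite_supp)
  show "supports (supp A) {P. models T P A}"
    unfolding supports_def
  proof (intro allI impI set_eqI)
    fix p P assume "\<forall>a\<in>supp A. p \<bullet> a = a"
    then have "p \<bullet> A = A" by (rule permute_eq_if_supp_fixed)
    then show "P \<in> p \<bullet> {P. models T P A} \<longleftrightarrow> P \<in> {P. models T P A}"
      using models_permute_right[OF assms, of P p A] by (simp add: mem_permute_iff')
  qed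
qed

lemma S_transform_simps [simp]:
  "trans (S_transform T) P (Inl \<alpha>) P' \<longleftrightarrow> trans T P \<alpha> P'"
  "trans (S_transform T) P (Inr \<phi>) P' \<longleftrightarrow> P' = P \<and> sat T P \<phi>"
  "tau (S_transform T) = Inl (tau T)"
  "tau_steps (S_transform T) = tau_steps T"
  "Inl \<alpha> \<in> acts (S_transform T) \<longleftrightarrow> \<alpha> \<in> acts T"
  "Inr \<phi> \<in> acts (S_transform T) \<longleftrightarrow> \<phi> \<in> preds T"
  by (auto simp: S_transform_def tau_steps_def)

text \<open>The alpha-variants of the two formulas differ with the supports of \<open>A\<close> and
  \<open>A'\<close>. Taking \<open>N\<close> to contain both supports makes
  \<open>models_Act_fresh\<close> use the same renamings on both sides, and equivariance transfers
  the agreement of \<open>A\<close> and \<open>A'\<close> to their renamed copies.\<close>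

lemma models_S_transform_Act:
  fixes A :: "('k, 'p::fs, 'a::bn) formula" and A' :: "('k, 'p, 'a + 'p) formula"
  assumes T: "nominal_ts T" and A: "\<And>P. models T P A \<longleftrightarrow> models (S_transform T) P A'"
  shows "models T P (Act \<alpha> A) \<longleftrightarrow> models (S_transform T) P (Act (Inl \<alpha>) A')"
proof -
  let ?N = "supp \<alpha> \<union> supp A \<union> supp A'"
  have fin: "finite ?N" by (simp add: finite_supp)
  have S: "nominal_ts (S_transform T)" by (rule nominal_ts_S_transform[OF T])
  have bn: "bn (Inl \<beta> :: 'a + 'p) = bn \<beta>" for \<beta> by (simp add: bn_sum_def)
  have "models T P' (p \<bullet> A) \<longleftrightarrow> models (S_transform T) P' (p \<bullet> A')" for p P'
    by (simp add: models_permute_right[OF T] models_permute_right[OF S] A)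
  then show ?thesis
    using models_Act_fresh[OF T fin, of \<alpha> A P] models_Act_fresh[OF S fin, of "Inl \<alpha>" A' P]
    by (simp add: bn Un_assoc le_supI2)
qed

text \<open>A predicate used as an action binds no names, so there is no other alpha-variant, and
  its only transitions are self-loops.\<close>

lemma models_S_transform_Inr:
  fixes A :: "('k, 'p::fs, 'a::bn + 'p) formula"
  shows "models (S_transform T) P (Act (Inr \<phi>) A) \<longleftrightarrow> sat T P \<phi> \<and> models (S_transform T) P A"
proof -
  have bn: "bn (Inr \<phi> :: 'a + 'p) = {}" for \<phi> by (simp add: bn_sum_def)
  have "Act (Inr \<phi>) A = Act \<beta> B \<longleftrightarrow> \<beta> = Inr \<phi> \<and> B = A" for \<beta> B
    unfolding Act_eq_iff bn
    using permute_eq_if_supp_fixed[of A] permute_eq_if_supp_fixed[of \<phi>]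
    by (auto intro: exI[of _ 0])
  then show ?thesis unfolding models_Act[of _ P "Inr \<phi>" A] using bn by auto
qed

text \<open>\<open>Q\<close> silently reaches some \<open>Q\<^sub>0\<close> equivalent to
  \<open>P'\<close>. As \<open>P'\<close> has a self-loop for \<open>\<phi>\<close>, there is a
  silent path from \<open>Q\<^sub>0\<close> through some \<open>Q\<^sub>1\<close> satisfying
  \<open>\<phi>\<close> to some \<open>Q\<^sub>2\<close> equivalent to \<open>P'\<close>. Stuttering
  puts \<open>Q\<^sub>1\<close> in the same class, so \<open>A\<close> holds at the very state where
  \<open>\<phi>\<close> does.\<close>

lemma weak_tau_pred_closed:
  fixes T :: "('s::fs, 'p::fs, 'a::bn) nts"
    and A :: "('k, 'p, 'a) formula" and A' :: "('k, 'p, 'a + 'p) formula"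
  assumes T: "nominal_ts T" and k: "natLeq <o |UNIV :: 'k set|" "|UNIV :: 's set| <o |UNIV :: 'k set|"
    and \<phi>: "\<phi> \<in> preds T"
    and A': "weak_formula (S_transform T) A'" "\<And>P. models T P A \<longleftrightarrow> models (S_transform T) P A'"
    and P: "models T P (weak_tau T (Conj {A, Pred \<phi>}))"
    and PQ: "weak_equiv TYPE('k) (S_transform T) P Q"
  shows "models T Q (weak_tau T (Conj {A, Pred \<phi>}))"
proof -
  let ?S = "S_transform T"
  have S: "nominal_ts ?S" by (rule nominal_ts_S_transform[OF T])
  have conj: "models T P (weak_tau T (Conj {A, Pred \<phi>})) \<longleftrightarrow>
      (\<exists>P'. tau_steps T P P' \<and> models T P' A \<and> sat T P' \<phi>)" for P
    by (simp add: models_weak_tau[OF T k(1)] conjunctible_insert_Pred[OF k(1)])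
  obtain P' where P': "tau_steps T P P'" "models T P' A" "sat T P' \<phi>"
    using P unfolding conj by blast
  \<comment> \<open>Testing with a characteristic formula instead of \<open>A'\<close> is what makes
    \<open>Q\<^sub>2\<close> equivalent to \<open>Q\<^sub>0\<close>, as stuttering requires.\<close>
  obtain C :: "('k, 'p, 'a + 'p) formula" where
    C: "weak_formula ?S C" "\<And>Q. models ?S Q C \<longleftrightarrow> weak_equiv TYPE('k) ?S P' Q"
    using characteristic_weak_formula[OF S k] by blast
  have refl: "weak_equiv TYPE('k) ?S P' P'" by (simp add: weak_equiv_def)
  have tau: "weak_formula ?S (weak_tau ?S C)"
    using weak_formula.intros(3)[of "tau ?S" ?S C] C(1) S by (simp add: nominal_ts_def weak_act_def)
  have "models ?S P (weak_tau ?S C)"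
    using P'(1) refl by (auto simp: models_weak_tau[OF S k(1)] C(2))
  then have "models ?S Q (weak_tau ?S C)" using weak_equivD[OF PQ tau] by blast
  then obtain Q\<^sub>0 where Q\<^sub>0: "tau_steps T Q Q\<^sub>0" "weak_equiv TYPE('k) ?S P' Q\<^sub>0"
    by (auto simp: models_weak_tau[OF S k(1)] C(2))
  have loop: "weak_formula ?S (weak_act ?S (Inr \<phi>) C)"
    by (rule weak_formula.intros(3)) (simp_all add: \<phi> C(1))
  have loop_iff: "models ?S R (weak_act ?S (Inr \<phi>) C) \<longleftrightarrow>
      (\<exists>R\<^sub>1 R\<^sub>2. tau_steps T R R\<^sub>1 \<and> sat T R\<^sub>1 \<phi> \<and> tau_steps T R\<^sub>1 R\<^sub>2 \<and> weak_equiv TYPE('k) ?S P' R\<^sub>2)" for R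
    by (auto simp: weak_act_def models_weak_tau[OF S k(1)] models_S_transform_Inr C(2))
  \<comment> \<open>The witness is the self-loop at \<open>P'\<close> itself, with no silent steps
    before or after it.\<close>
  have "models ?S P' (weak_act ?S (Inr \<phi>) C)"
    unfolding loop_iff using P'(3) refl by (auto simp: tau_steps_def)
  then have "models ?S Q\<^sub>0 (weak_act ?S (Inr \<phi>) C)" using weak_equivD[OF Q\<^sub>0(2) loop] by blast
  then obtain Q\<^sub>1 Q\<^sub>2 where Q\<^sub>1: "tau_steps T Q\<^sub>0 Q\<^sub>1" "sat T Q\<^sub>1 \<phi>"
    and Q\<^sub>2: "tau_steps T Q\<^sub>1 Q\<^sub>2" "weak_equiv TYPE('k) ?S P' Q\<^sub>2"
    unfolding loop_iff by blast
  have "weak_equiv TYPE('k) ?S Q\<^sub>0 Q\<^sub>2"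
    using Q\<^sub>0(2) Q\<^sub>2(2) weak_equiv_sym weak_equiv_trans by blast
  then have "weak_equiv TYPE('k) ?S Q\<^sub>0 Q\<^sub>1"
    by (intro weak_equiv_stuttering[OF S k(1), of Q\<^sub>0 Q\<^sub>1 Q\<^sub>2]) (simp_all add: Q\<^sub>1 Q\<^sub>2)
  then have "weak_equiv TYPE('k) ?S P' Q\<^sub>1" using Q\<^sub>0(2) weak_equiv_trans by blast
  then have "models T Q\<^sub>1 A" using P'(2) weak_equivD[OF _ A'(1)] by (simp add: A'(2))
  moreover have "tau_steps T Q Q\<^sub>1" using Q\<^sub>0(1) Q\<^sub>1(1) by (simp add: tau_steps_def)
  ultimately show ?thesis using Q\<^sub>1(2) unfolding conj by blast
qed

theorem theorem8p10:
  fixes T :: "('s::fs, 'p::fs, 'a::bn) nts"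
    and A :: "('k, 'p, 'a) formula"
  assumes "nominal_ts T"
    and "natLeq <o |UNIV :: 'k set|"
    and "|UNIV :: 's set| <o |UNIV :: 'k set|"
    and "weak_formula T A"
  shows "\<exists>A' :: ('k, 'p, 'a + 'p) formula. weak_formula (S_transform T) A' \<and>
    (\<forall>P. models T P A \<longleftrightarrow> models (S_transform T) P A')"
proof -
  let ?S = "S_transform T"
  note S = nominal_ts_S_transform[OF assms(1)]
  have closed: "\<exists>A' :: ('k, 'p, 'a + 'p) formula. weak_formula ?S A' \<and>
      (\<forall>P. models T P B \<longleftrightarrow> models ?S P A')"
    if "\<And>P Q. models T P B \<Longrightarrow> weak_equiv TYPE('k) ?S P Q \<Longrightarrow> models T Q B"
    for B :: "('k, 'p, 'a) formula"
    using expressive_completeness[OF S assms(2,3) finitely_supported_models[OF assms(1), of B]] that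
    by auto
  show ?thesis
    using assms(4)
  proof induction
    case (1 X)
    show ?case
    proof (rule closed)
      \<comment> \<open>The induction hypothesis serves only to show invariance: each conjunct has
        some translation, so equivalent states agree on it.\<close>
      fix P Q assume "models T P (Conj X)" "weak_equiv TYPE('k) ?S P Q"
      then show "models T Q (Conj X)"
        using 1 by simp (metis weak_equivD)
    qed
  next
    case (2 A)
    then show ?case by (metis models_Neg weak_formula.intros(2))
  next
    case (3 \<alpha> A)
    then obtain A' :: "('k, 'p, 'a + 'p) formula" where
      A': "weak_formula ?S A'" "\<And>P. models T P A \<longleftrightarrow> models ?S P A'" by blast
    have tau: "models T P (weak_tau T B) \<longleftrightarrow> models ?S P (weak_tau ?S B')"
      if "\<And>P. models T P B \<longleftrightarrow> models ?S P B'"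
      for P and B :: "('k, 'p, 'a) formula" and B' :: "('k, 'p, 'a + 'p) formula"
      by (simp add: models_weak_tau[OF assms(1,2)] models_weak_tau[OF S assms(2)] that)
    \<comment> \<open>For \<alpha> other than \<tau>, the equivalence is built from the inside out:
      silent diamond, action, silent diamond.\<close>
    have "models T P (weak_act T \<alpha> A) \<longleftrightarrow> models ?S P (weak_act ?S (Inl \<alpha>) A')" for P
      using tau[OF A'(2)] tau[OF models_S_transform_Act[OF assms(1) tau[OF A'(2)]]]
      by (simp add: weak_act_def)
    moreover have "weak_formula ?S (weak_act ?S (Inl \<alpha>) A')"
      using 3 A'(1) by (simp add: weak_formula.intros(3))
    ultimately show ?case by blast
  next
    case (4 \<phi> A)
    then obtain A' :: "('k, 'p, 'a + 'p) formula" where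
      A': "weak_formula ?S A'" "\<And>P. models T P A \<longleftrightarrow> models ?S P A'" by blast
    show ?case
      by (rule closed) (rule weak_tau_pred_closed[OF assms(1-3) 4(1) A'])
  qed
qed

end
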